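(* Let $p_1,p_2,q_1,q_2$ be integers with $0\le p_1\le q_1+1$, $p_2\ge 1$, $0\le q_2\le p_2$ and $p_1+p_2\le q_1+q_2+1$. Put $p=p_1+p_2$ and $q=q_1+q_2$. Let $\mathbf{a}_1\in\mathbb{R}^{p_1}$, $\mathbf{a}_2\in\mathbb{R}^{p_2}$, $\mathbf{b}_1\in\mathbb{R}^{q_1}$, $\mathbf{b}_2\in\mathbb{R}^{q_2}$, where no component of $\mathbf{b}_1$ or $\mathbf{b}_2$ is a non-positive integer. Suppose that $\mathbf{a}_2>0$ and that there exists a subvector $\mathbf{a}_2'$ of $\mathbf{a}_2$ with exactly $q_2$ components such that $v_{\mathbf{a}_2',\mathbf{b}_2}(t)\ge 0$ for $t\in[0,1]$. Let $x\in\mathbb{R}$, with $x<1$ if $p=q+1$, and assume that $${}_{p_1}F_{q_1}(\mathbf{a}_1;\mathbf{b}_1;xt)\ge 0$$ for all $t>0$ if $p_1\le q_1$, or for all $0<t<1$ if $p_1=q_1+1$. For $\mu\ge 0$ define $$f(\mu;x)=\frac{\Gamma(\mathbf{a}_2+\mu)}{\Gamma(\mathbf{b}_2+\mu)}\,{}_pF_q\left(\mathbf{a}_1,\mathbf{a}_2+\mu;\ \mathbf{b}_1,\mathbf{b}_2+\mu;\ x\right).$$ Then for all $\alpha,\beta>0$ and $\mu\ge 0$, $$0\le f(\mu;x)f(\mu+\alpha+\beta;x)-f(\mu+\alpha;x)f(\mu+\beta;x),$$ which is equivalent to log-convexity of $\mu\mapsto f(\mu;x)$ on $[0,\infty)$.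 If, in addition, $p_2=q_2$, then for all $\alpha,\beta>0$ and $\mu\ge 0$ also $$f(\mu;x)f(\mu+\alpha+\beta;x)-f(\mu+\alpha;x)f(\mu+\beta;x)\le\frac14 f(\mu;x)^2 .$$
   Context: For parameter vectors $\mathbf{a}=(a_1,\dots,a_p)$ and $\mathbf{b}=(b_1,\dots,b_q)$ with no $b_j$ a non-positive integer, the generalized hypergeometric function is ${}_pF_q(\mathbf{a};\mathbf{b};z)=\sum_{n\ge0}\frac{(a_1)_n\cdots(a_p)_n}{(b_1)_n\cdots(b_q)_n\,n!}z^n$ for $z\in\mathbb{C}$ if $p\le q$. If $p=q+1$ the series converges in the open unit disk, and ${}_pF_q(z)$ denotes its analytic continuation to $\mathbb{C}\setminus[1,\infty)$. Here $(a)_n=\Gamma(a+n)/\Gamma(a)=a(a+1)\cdots(a+n-1)$ is the rising factorial. Vectors may be empty (empty products equal $1$, empty sums equal $0$; e.g. ${}_0F_0(z)=e^z$). Write $\Gamma(\mathbf{a})=\prod_i\Gamma(a_i)$ and $\mathbf{a}+\mu=(a_1+\mu,\dots,a_p+\mu)$; $\mathbf{a}>0$ means every component is positive. A subvector is obtained by deleting some components (by position). For two real vectors $\mathbf{a},\mathbf{b}$ of equal length $m$, $v_{\mathbf{a},\mathbf{b}}(t)=\sum_{k=1}^{m}(t^{a_k}-t^{b_k})$. *)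

theory Defs
  imports "HOL-Complex_Analysis.Complex_Analysis" "HOL-Library.Sublist"
begin

abbreviation slit_plane :: "complex set" where
  "slit_plane \<equiv> - (complex_of_real ` {1..})"

abbreviation hypergeo_series :: "complex list \<Rightarrow> complex list \<Rightarrow> complex \<Rightarrow> complex" where
  "hypergeo_series as bs z \<equiv> eval_fps (fps_hypergeo as bs 1) z"

definition continues_series :: "complex list \<Rightarrow> complex list \<Rightarrow> (complex \<Rightarrow> complex) \<Rightarrow> bool" where
  "continues_series as bs g \<longleftrightarrow>
     g holomorphic_on slit_plane \<and> (\<forall>z\<in>ball 0 1. g z = hypergeo_series as bs z)"

text \<open>
  The function pFq is meant for length as \<le> length bs + 1, no entry of bs being a
  non-positive integer, and, if length as = length bs + 1, arguments in the slit plane.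
  The choice operator is harmless: the continuation is determined on the slit plane, see
  hypergeo_eqI below.
\<close>

definition hypergeo :: "complex list \<Rightarrow> complex list \<Rightarrow> complex \<Rightarrow> complex" where
  "hypergeo as bs z =
     (if length as = length bs + 1 then (SOME g. continues_series as bs g) z
      else hypergeo_series as bs z)"

lemma continues_series_unique:
  assumes "continues_series as bs g" "continues_series as bs h" "z \<in> slit_plane"
  shows "g z = h z"
proof -
  have op: "open slit_plane"
    by (intro open_Compl closed_slot_right)
  have con: "connected slit_plane"
    by (intro starlike_imp_connected starlike_slotted_complex_plane_right)
  have sub: "ball 0 1 \<subseteq> slit_plane"
    by auto
  have hol: "(\<lambda>w. g w - h w) holomorphic_on slit_plane"
    using assms by (auto simp: continues_series_def intro: holomorphic_on_diff)
  have lim: "(0::complex) islimpt ball 0 1"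
    by (simp add: islimpt_ball)
  have "g z - h z = 0"
    using sub assms(1,2)
    by (intro analytic_continuation[OF hol op con sub _ lim _ assms(3)])
       (auto simp: continues_series_def)
  thus ?thesis by simp
qed

lemma hypergeo_eqI:
  assumes "length as = length bs + 1" "continues_series as bs g" "z \<in> slit_plane"
  shows "hypergeo as bs z = g z"
  using continues_series_unique[OF someI[of "continues_series as bs"] assms(2,3), OF assms(2)] assms(1)
  by (simp add: hypergeo_def)

text \<open>
  For real parameters and real argument (x < 1 if length as = length bs + 1), the value of
  pFq is real, so that taking the real part loses nothing.
\<close>

definition hypergeo_real :: "real list \<Rightarrow> real list \<Rightarrow> real \<Rightarrow> real" where
  "hypergeo_real as bs x =
     Re (hypergeo (map complex_of_real as) (map complex_of_real bs) (complex_of_real x))"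

definition v_fun :: "real list \<Rightarrow> real list \<Rightarrow> real \<Rightarrow> real" where
  "v_fun as bs t = (\<Sum>k<length as. t powr (as ! k) - t powr (bs ! k))"

definition shift :: "real \<Rightarrow> real list \<Rightarrow> real list" where
  "shift \<mu> as = map (\<lambda>a. a + \<mu>) as"

definition Gamma_prod :: "real list \<Rightarrow> real" where
  "Gamma_prod as = prod_list (map Gamma as)"

definition f_hyp ::
    "real list \<Rightarrow> real list \<Rightarrow> real list \<Rightarrow> real list \<Rightarrow> real \<Rightarrow> real \<Rightarrow> real" where
  "f_hyp a1 a2 b1 b2 \<mu> x =
     Gamma_prod (shift \<mu> a2) / Gamma_prod (shift \<mu> b2) *
     hypergeo_real (a1 @ shift \<mu> a2) (b1 @ shift \<mu> b2) x"

text \<open>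
  Log-convexity is stated multiplicatively for nonnegative functions, since a log-convex
  function may vanish (convexity of ln \<circ> f would rely on the convention ln 0 = 0).
  The weights lie strictly between 0 and 1 because 0 powr 0 = 0.
\<close>

definition log_convex_on :: "real set \<Rightarrow> (real \<Rightarrow> real) \<Rightarrow> bool" where
  "log_convex_on S f \<longleftrightarrow> convex S \<and> (\<forall>u\<in>S. f u \<ge> 0) \<and>
     (\<forall>u\<in>S. \<forall>v\<in>S. \<forall>s. 0 < s \<and> s < 1 \<longrightarrow>
        f ((1 - s) * u + s * v) \<le> f u powr (1 - s) * f v powr s)"

end

theory Submission
  imports Defs "HOL-Real_Asymp.Real_Asymp"
begin

text \<open>
  Write \<open>c k\<close> for the coefficients of \<open>F(a1; b1; z)\<close> and \<open>M(s) = \<Gamma>(a2 + s) / \<Gamma>(b2 + s)\<close>.  Because of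
  \<open>\<Gamma>(a + \<mu>) * (a + \<mu>)\<^sub>k = \<Gamma>(a + \<mu> + k)\<close>, the function \<open>f(\<mu>; x)\<close> is the sum of \<open>c k * M(\<mu> + k) * x ^ k\<close>.  If \<open>M(s)\<close> is
  the integral of \<open>t powr s\<close> against a measure \<open>\<nu> \<ge> 0\<close>, then \<open>f(\<mu>; x)\<close> is the integral of
  \<open>t powr \<mu> * F(a1; b1; x t)\<close>: a superposition, with nonnegative weights, of functions that are log-linear
  in \<open>\<mu>\<close>.  Such a superposition is log-convex by Hoelder's inequality, and log-convexity implies the four-point
  inequality (\<open>log_convex_imp_four_point\<close>).  For \<open>p2 = q2\<close> the measure lives on \<open>{0..1}\<close>, so \<open>f\<close> is moreover decreasing
  in \<open>\<mu>\<close>, and the upper bound follows by completing a square (\<open>antimono_imp_quarter_bound\<close>).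

  The measure itself is never constructed.  For equally many parameters above and below, the condition
  \<open>v \<ge> 0\<close> says that the negative logarithmic derivatives of the factors in Euler's product for \<open>M\<close> are Mellin
  transforms of a nonnegative density; hence \<open>M\<close> is completely monotone (\<open>completely_monotone_Gamma_ratio\<close>).  Hausdorff's
  construction turns the finite differences of \<open>M\<close> into nonnegative weights on the grid \<open>i / n\<close> whose moments converge to
  \<open>M\<close> (\<open>completely_monotone_discrete_approx\<close>).  Sums of \<open>F(a1; b1; x i / n)\<close> against these weights converge to \<open>f\<close>: termwise inside
  the disk of convergence, and in the slit plane by Montel's theorem (\<open>moment_approx_slit_plane\<close>).  The latter
  lemma, applied repeatedly to \<open>1 / (1 - z)\<close>, also proves that the series with \<open>p = q + 1\<close> has an analytic continuation
  to the slit plane at all (\<open>slit_sum_pochhammer_products\<close>).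

  The components of \<open>a2\<close> outside \<open>a2'\<close> are added one at a time.  A further component \<open>e\<close> replaces \<open>f(\<mu>; x)\<close> by the
  integral of \<open>t powr (e + \<mu> - 1) * exp (- t) * f(\<mu>; x t)\<close> over \<open>t > 0\<close>, and log-convexity survives integration.  The only
  delicate point is the last component when \<open>p = q + 1\<close> and \<open>x \<le> - 1\<close>: the value is then defined by
  continuation instead of the series, and even the convergence of the integral is unclear.  It follows from Landau's theorem on
  Laplace transforms of nonnegative functions (\<open>landau_laplace\<close>), for which the nonnegativity already proved for
  the inner function is exactly what is needed.
\<close>

section \<open>Complete monotonicity by finite differences\<close>

primrec bdiff :: "real \<Rightarrow> nat \<Rightarrow> (real \<Rightarrow> real) \<Rightarrow> real \<Rightarrow> real" where
  "bdiff h 0 f = f"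
| "bdiff h (Suc m) f = bdiff h m (\<lambda>s. f s - f (s + h))"

text \<open>
  This is complete monotonicity as Hausdorff uses it, with differences of every step in place of
  derivatives.  It is closed under products and pointwise limits by purely algebraic arguments,
  and the differences are, up to binomial coefficients, the weights constructed below.
\<close>

definition completely_monotone_from :: "real \<Rightarrow> (real \<Rightarrow> real) \<Rightarrow> bool" where
  "completely_monotone_from s0 f \<longleftrightarrow> (\<forall>h>0. \<forall>m. \<forall>s\<ge>s0. bdiff h m f s \<ge> 0)"

lemma bdiff_add: "bdiff h m (\<lambda>s. f s + g s) s = bdiff h m f s + bdiff h m g s"
proof (induction m arbitrary: f g)
  case (Suc m)
  have "(\<lambda>s. (f s + g s) - (f (s + h) + g (s + h)))
        = (\<lambda>s. (f s - f (s + h)) + (g s - g (s + h)))"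
    by (simp add: fun_eq_iff)
  thus ?case using Suc by simp
qed simp

lemma bdiff_shift: "bdiff h m (\<lambda>s. f (s + c)) s = bdiff h m f (s + c)"
proof (induction m arbitrary: f)
  case (Suc m)
  show ?case using Suc[of "\<lambda>s. f s - f (s + h)"] by (simp add: add_ac)
qed simp

text \<open>
  Induction with the product rule
  \<open>f s * g s - f (s + h) * g (s + h) = f s * (g s - g (s + h)) + (f s - f (s + h)) * g (s + h)\<close>:
  both summands are again products of two functions of the same kind.
\<close>

lemma bdiff_mult_nonneg:
  assumes "h > 0"
    and "\<And>m s. s \<ge> s0 \<Longrightarrow> bdiff h m f s \<ge> 0"
    and "\<And>m s. s \<ge> s0 \<Longrightarrow> bdiff h m g s \<ge> 0"
    and "s \<ge> s0"
  shows "bdiff h m (\<lambda>s. f s * g s) s \<ge> 0"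
  using assms(2-4)
proof (induction m arbitrary: f g s)
  case 0
  from "0.prems"(1)[of s 0] "0.prems"(2)[of s 0] "0.prems"(3) show ?case by simp
next
  case (Suc m)
  have eq: "(\<lambda>s. f s * g s - f (s + h) * g (s + h))
        = (\<lambda>s. f s * (g s - g (s + h)) + (f s - f (s + h)) * g (s + h))"
    by (simp add: fun_eq_iff algebra_simps)
  have "bdiff h m (\<lambda>s. f s * (g s - g (s + h))) s \<ge> 0"
    using Suc.prems(1,3) Suc.prems(2)[of _ "Suc _"] by (intro Suc.IH) auto
  moreover have "bdiff h m (\<lambda>s. (f s - f (s + h)) * g (s + h)) s \<ge> 0"
    using Suc.prems(1)[of _ "Suc _"] Suc.prems(2,3) assms(1)
    by (intro Suc.IH) (auto simp: bdiff_shift)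
  ultimately show ?case by (simp only: bdiff.simps eq bdiff_add)
qed

lemma completely_monotone_mult:
  assumes "completely_monotone_from s0 f" "completely_monotone_from s0 g"
  shows "completely_monotone_from s0 (\<lambda>s. f s * g s)"
  using assms bdiff_mult_nonneg[of _ s0 f g] by (auto simp: completely_monotone_from_def)

lemma completely_monotone_add:
  assumes "completely_monotone_from s0 f" "completely_monotone_from s0 g"
  shows "completely_monotone_from s0 (\<lambda>s. f s + g s)"
  using assms by (auto simp: completely_monotone_from_def bdiff_add)

lemma bdiff_0: "bdiff h m (\<lambda>s. 0) s = 0"
  by (induction m) auto

lemma completely_monotone_const:
  assumes "c \<ge> 0"
  shows "completely_monotone_from s0 (\<lambda>s. c)"
proof -
  have "bdiff h m (\<lambda>s. c) s \<ge> 0" for h m s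
    using assms by (cases m) (auto simp: bdiff_0)
  thus ?thesis by (auto simp: completely_monotone_from_def)
qed

lemma completely_monotone_shift:
  assumes "completely_monotone_from s0 f" "c \<ge> 0"
  shows "completely_monotone_from s0 (\<lambda>s. f (s + c))"
  using assms by (auto simp: completely_monotone_from_def bdiff_shift)

lemma completely_monotone_power:
  assumes "completely_monotone_from s0 f"
  shows "completely_monotone_from s0 (\<lambda>s. f s ^ n)"
  by (induction n) (auto intro: completely_monotone_const completely_monotone_mult assms)

lemma completely_monotone_sum:
  assumes "\<And>i. i \<in> I \<Longrightarrow> completely_monotone_from s0 (f i)"
  shows "completely_monotone_from s0 (\<lambda>s. \<Sum>i\<in>I. f i s)"
  using assms
  by (induction I rule: infinite_finite_induct)
     (auto intro: completely_monotone_const completely_monotone_add)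

lemma completely_monotone_prod:
  assumes "\<And>i. i \<in> I \<Longrightarrow> completely_monotone_from s0 (f i)"
  shows "completely_monotone_from s0 (\<lambda>s. \<Prod>i\<in>I. f i s)"
  using assms
  by (induction I rule: infinite_finite_induct)
     (auto intro: completely_monotone_const completely_monotone_mult)

lemma bdiff_tendsto:
  assumes "\<And>s. s \<ge> s0 \<Longrightarrow> (\<lambda>n. F n s) \<longlonglongrightarrow> f s" "s \<ge> s0" "h > 0"
  shows "(\<lambda>n. bdiff h m (F n) s) \<longlonglongrightarrow> bdiff h m f s"
  using assms(1,2)
proof (induction m arbitrary: F f s)
  case (Suc m)
  show ?case unfolding bdiff.simps
    using Suc.prems \<open>h > 0\<close> by (intro Suc.IH tendsto_diff) auto
qed simp

lemma completely_monotone_limit: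
  assumes "\<And>n. completely_monotone_from s0 (F n)"
    and "\<And>s. s \<ge> s0 \<Longrightarrow> (\<lambda>n. F n s) \<longlonglongrightarrow> f s"
  shows "completely_monotone_from s0 f"
  unfolding completely_monotone_from_def
proof (intro allI impI)
  fix h s :: real and m :: nat assume "h > 0" "s \<ge> s0"
  show "bdiff h m f s \<ge> 0"
    by (rule LIMSEQ_le_const[OF bdiff_tendsto[OF assms(2) \<open>s \<ge> s0\<close> \<open>h > 0\<close>]])
       (use assms(1) \<open>h > 0\<close> \<open>s \<ge> s0\<close> in \<open>auto simp: completely_monotone_from_def\<close>)
qed

text \<open>
  The partial sums of the exponential series have nonnegative coefficients.
\<close>

lemma completely_monotone_exp:
  assumes "completely_monotone_from s0 f"
  shows "completely_monotone_from s0 (\<lambda>s. exp (f s))"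
proof (rule completely_monotone_limit)
  show "completely_monotone_from s0 (\<lambda>s. \<Sum>k<n. inverse (fact k) * f s ^ k)" for n
    by (intro completely_monotone_sum completely_monotone_mult completely_monotone_const
              completely_monotone_power assms) auto
  show "(\<lambda>n. \<Sum>k<n. inverse (fact k) * f s ^ k) \<longlonglongrightarrow> exp (f s)" for s
    using exp_converges[of "f s"] by (simp add: sums_def)
qed

text \<open>
  A difference of step \<open>h\<close> of the Mellin transform of \<open>w\<close> is the Mellin transform of
  \<open>w t * (1 - t powr h)\<close>, whose density is again nonnegative on \<open>{0..1}\<close>.
\<close>

lemma bdiff_has_integral_nonneg:
  assumes "\<And>s. s \<ge> s0 \<Longrightarrow> ((\<lambda>t. t powr (s - 1) * w t) has_integral f s) {0..1}"
    and "\<And>t. 0 \<le> t \<Longrightarrow> t \<le> 1 \<Longrightarrow> w t \<ge> 0" "s \<ge> s0" "h > 0"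
  shows "bdiff h m f s \<ge> 0"
  using assms(1-3)
proof (induction m arbitrary: w f)
  case 0
  show ?case unfolding bdiff.simps
    by (rule has_integral_nonneg[OF "0.prems"(1)[OF assms(3)]]) (use "0.prems"(2) in auto)
next
  case (Suc m)
  show ?case unfolding bdiff.simps
  proof (rule Suc.IH[where w = "\<lambda>t. w t * (1 - t powr h)"])
    fix s assume s: "s \<ge> s0"
    have "((\<lambda>t. t powr (s - 1) * w t - t powr (s + h - 1) * w t) has_integral f s - f (s + h)) {0..1}"
      using s \<open>h > 0\<close> by (intro has_integral_diff Suc.prems(1)) auto
    also have "(\<lambda>t. t powr (s - 1) * w t - t powr (s + h - 1) * w t)
        = (\<lambda>t. t powr (s - 1) * (w t * (1 - t powr h)))"
      by (auto simp: fun_eq_iff algebra_simps simp flip: powr_add)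
    finally show "((\<lambda>t. t powr (s - 1) * (w t * (1 - t powr h))) has_integral f s - f (s + h)) {0..1}" .
  qed (use Suc.prems(2,3) \<open>h > 0\<close> in \<open>auto intro!: mult_nonneg_nonneg simp: powr_le1\<close>)
qed

lemma bdiff_has_derivative:
  assumes "\<And>s. s \<ge> s0 \<Longrightarrow> (f has_real_derivative - k s) (at s)" "s \<ge> s0" "h > 0"
  shows "(bdiff h m f has_real_derivative - bdiff h m k s) (at s)"
  using assms(1,2)
proof (induction m arbitrary: f k s)
  case (Suc m)
  show ?case unfolding bdiff.simps
  proof (rule Suc.IH)
    fix s assume s: "s \<ge> s0"
    have "((\<lambda>s. f (s + h)) has_real_derivative - k (s + h)) (at s)"
      using Suc.prems(1)[of "s + h"] s \<open>h > 0\<close> by (auto simp: DERIV_shift)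
    from DERIV_diff[OF Suc.prems(1)[OF s] this]
    show "((\<lambda>s. f s - f (s + h)) has_real_derivative - (k s - k (s + h))) (at s)" by simp
  qed fact
qed simp

lemma bdiff_tendsto_0_at_top:
  assumes "(f \<longlongrightarrow> 0) at_top"
  shows "(bdiff h m f \<longlongrightarrow> 0) at_top"
  using assms
proof (induction m arbitrary: f)
  case (Suc m)
  have "filterlim (\<lambda>s::real. s + h) at_top at_top"
    by (subst add.commute) (intro filterlim_tendsto_add_at_top[OF tendsto_const] filterlim_ident)
  from filterlim_compose[OF Suc.prems this]
  have "((\<lambda>s. f s - f (s + h)) \<longlongrightarrow> 0 - 0) at_top"
    by (intro tendsto_diff Suc.prems)
  thus ?case unfolding bdiff.simps by (intro Suc.IH) simp
qed simp

text \<open>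
  Each difference of \<open>f\<close> has a derivative of constant sign, hence decreases to its limit \<open>0\<close> at
  infinity, and so is nonnegative.  This replaces a representation of \<open>f\<close> itself as a Mellin
  transform (Frullani's integral) by the much simpler one of its derivative.
\<close>

lemma completely_monotone_from_derivative:
  assumes der: "\<And>s. s \<ge> s0 \<Longrightarrow> (f has_real_derivative - k s) (at s)"
    and int: "\<And>s. s \<ge> s0 \<Longrightarrow> ((\<lambda>t. t powr (s - 1) * w t) has_integral k s) {0..1}"
    and w: "\<And>t. 0 \<le> t \<Longrightarrow> t \<le> 1 \<Longrightarrow> w t \<ge> 0"
    and lim: "(f \<longlongrightarrow> 0) at_top"
  shows "completely_monotone_from s0 f"
  unfolding completely_monotone_from_def
proof (intro allI impI)
  fix h s :: real and m :: nat assume h: "h > 0" and s: "s \<ge> s0"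
  have "bdiff h m f u \<le> bdiff h m f s" if "u \<ge> s" for u
  proof (rule DERIV_nonpos_imp_nonincreasing[OF that])
    fix y assume "s \<le> y" "y \<le> u"
    hence y: "y \<ge> s0" using s by simp
    show "\<exists>d. (bdiff h m f has_real_derivative d) (at y) \<and> d \<le> 0"
      using bdiff_has_derivative[OF der y h] bdiff_has_integral_nonneg[OF int w y h]
      by (intro exI[of _ "- bdiff h m k y"]) auto
  qed
  thus "bdiff h m f s \<ge> 0"
    by (intro tendsto_upperbound[OF bdiff_tendsto_0_at_top[OF lim]])
       (auto intro!: eventually_mono[OF eventually_ge_at_top[of s]])
qed

section \<open>Weights on a grid with prescribed moments\<close>

text \<open>
  With \<open>T\<close> the shift by \<open>h\<close>, this is the binomial expansion of the operator \<open>(T + (1 - T)) ^ n = 1\<close>.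
\<close>

lemma bdiff_binomial_sum:
  "(\<Sum>i\<le>n. real (n choose i) * bdiff h (n - i) f (s + real i * h)) = f s"
proof (induction n arbitrary: f s)
  case (Suc n)
  let ?g = "\<lambda>s. f s - f (s + h)"
  have "(\<Sum>i\<le>Suc n. real (Suc n choose i) * bdiff h (Suc n - i) f (s + real i * h))
      = bdiff h (Suc n) f s + (\<Sum>i\<le>n. real (n choose i) * bdiff h (n - i) f (s + h + real i * h))
        + (\<Sum>i\<le>n. real (n choose Suc i) * bdiff h (n - i) f (s + real (Suc i) * h))"
    by (subst sum.atMost_Suc_shift) (simp add: sum.distrib ring_distribs add_ac)
  also have "(\<Sum>i\<le>n. real (n choose i) * bdiff h (n - i) f (s + h + real i * h)) = f (s + h)"
    by (rule Suc)
  also have "(\<Sum>i\<le>n. real (n choose Suc i) * bdiff h (n - i) f (s + real (Suc i) * h))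
      = (\<Sum>i<n. real (n choose Suc i) * bdiff h (n - Suc i) ?g (s + real (Suc i) * h))"
  proof -
    have "(\<Sum>i\<le>n. real (n choose Suc i) * bdiff h (n - i) f (s + real (Suc i) * h))
        = (\<Sum>i<n. real (n choose Suc i) * bdiff h (n - i) f (s + real (Suc i) * h))"
      by (simp add: lessThan_Suc_atMost[symmetric])
    also have "\<dots> = (\<Sum>i<n. real (n choose Suc i) * bdiff h (n - Suc i) ?g (s + real (Suc i) * h))"
    proof (intro sum.cong refl)
      fix i assume "i \<in> {..<n}"
      hence "n - i = Suc (n - Suc i)" by auto
      thus "real (n choose Suc i) * bdiff h (n - i) f (s + real (Suc i) * h) =
            real (n choose Suc i) * bdiff h (n - Suc i) ?g (s + real (Suc i) * h)"
        by (simp only: bdiff.simps)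
    qed
    finally show ?thesis .
  qed
  also have "bdiff h (Suc n) f s + f (s + h) + \<dots>
      = (\<Sum>i\<le>n. real (n choose i) * bdiff h (n - i) ?g (s + real i * h)) + f (s + h)"
    by (subst sum.atMost_shift) simp
  also have "\<dots> = f s" by (subst Suc) simp
  finally show ?case .
qed simp

text \<open>
  The product is \<open>i (i - 1) \<dots> (i - k + 1) / (n (n - 1) \<dots> (n - k + 1))\<close>; it is close to
  \<open>(i / n) ^ k\<close> but combines exactly with the binomial coefficient.
\<close>

lemma binomial_falling_ratio:
  assumes "k \<le> n" "i \<le> n"
  shows "real (n choose i) * (\<Prod>j<k. (real i - real j) / (real n - real j))
       = (if k \<le> i then real (n - k choose (i - k)) else 0)"
  using assms
proof (induction k)
  case (Suc k)
  have "real (n choose i) * (\<Prod>j<Suc k. (real i - real j) / (real n - real j))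
      = (if k \<le> i then real (n - k choose (i - k)) else 0) * ((real i - real k) / (real n - real k))"
    using Suc by (simp flip: mult.assoc)
  also have "\<dots> = (if Suc k \<le> i then real (n - Suc k choose (i - Suc k)) else 0)"
  proof (cases "Suc k \<le> i")
    case True
    define a b where "a = n - Suc k" and "b = i - Suc k"
    have ab: "n - k = Suc a" "i - k = Suc b" "real i - real k = real (Suc b)" "real n - real k = real (Suc a)"
      using True Suc.prems by (auto simp: a_def b_def)
    have "real (Suc a choose Suc b) * real (Suc b) = real (Suc a) * real (a choose b)"
      by (metis binomial_absorption mult.commute of_nat_mult diff_Suc_1)
    hence "real (Suc a choose Suc b) * (real (Suc b) / real (Suc a)) = real (a choose b)"
      by (simp add: field_simps del: of_nat_Suc binomial_Suc_Suc)
    thus ?thesis using True by (simp only: ab a_def[symmetric] b_def[symmetric]) simp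
  next
    case False
    thus ?thesis by (cases "i = k") auto
  qed
  finally show ?case .
qed auto

text \<open>
  The integral of \<open>\<phi>\<close> against the discrete measure with mass \<open>W n i\<close> at the point \<open>T n i\<close>.
\<close>

definition wsum :: "(nat \<Rightarrow> nat \<Rightarrow> real) \<Rightarrow> (nat \<Rightarrow> nat \<Rightarrow> real) \<Rightarrow> nat \<Rightarrow> (real \<Rightarrow> real) \<Rightarrow> real" where
  "wsum W T n \<phi> = (\<Sum>i\<le>n. W n i * \<phi> (T n i))"

definition has_limit_moments ::
    "(nat \<Rightarrow> nat \<Rightarrow> real) \<Rightarrow> (nat \<Rightarrow> nat \<Rightarrow> real) \<Rightarrow> (nat \<Rightarrow> real) \<Rightarrow> bool" where
  "has_limit_moments W T m \<longleftrightarrow>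
     (\<forall>n. \<forall>i\<le>n. 0 \<le> W n i \<and> 0 \<le> T n i \<and> T n i \<le> 1) \<and>
     (\<forall>k. (\<lambda>n. wsum W T n (\<lambda>t. t ^ k)) \<longlonglongrightarrow> m k)"

lemma wsum_diff_bound:
  assumes "has_limit_moments W T m" "\<And>t. 0 \<le> t \<Longrightarrow> t \<le> 1 \<Longrightarrow> \<bar>\<phi> t - \<psi> t\<bar> \<le> e"
  shows "\<bar>wsum W T n \<phi> - wsum W T n \<psi>\<bar> \<le> e * wsum W T n (\<lambda>t. 1)"
proof -
  have "\<bar>wsum W T n \<phi> - wsum W T n \<psi>\<bar> = \<bar>\<Sum>i\<le>n. W n i * (\<phi> (T n i) - \<psi> (T n i))\<bar>"
    by (simp add: wsum_def sum_subtractf right_diff_distrib)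
  also have "\<dots> \<le> (\<Sum>i\<le>n. W n i * e)"
    using assms unfolding has_limit_moments_def
    by (intro order_trans[OF sum_abs] sum_mono) (auto simp: abs_mult intro!: mult_left_mono)
  finally show ?thesis by (simp add: wsum_def sum_distrib_left mult.commute)
qed

lemma wsum_polynomial_tendsto:
  assumes "has_limit_moments W T m"
  shows "(\<lambda>n. wsum W T n (\<lambda>t. \<Sum>k\<le>d. a k * t ^ k)) \<longlonglongrightarrow> (\<Sum>k\<le>d. a k * m k)"
proof -
  have "(\<lambda>n. wsum W T n (\<lambda>t. \<Sum>k\<le>d. a k * t ^ k)) = (\<lambda>n. \<Sum>k\<le>d. a k * wsum W T n (\<lambda>t. t ^ k))"
    by (simp add: wsum_def sum_distrib_left fun_eq_iff mult_ac) (subst sum.swap, simp)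
  thus ?thesis using assms by (auto simp: has_limit_moments_def intro!: tendsto_intros)
qed

text \<open>
  By Weierstrass' theorem a continuous function on \<open>{0..1}\<close> is uniformly close to a polynomial, and
  the integrals of polynomials converge to limits given by the moments.  Taking the same system
  twice yields the Cauchy property, taking the same index twice yields equality of limits.
\<close>

lemma equal_moments_imp_close:
  assumes "has_limit_moments W T m" "has_limit_moments W' T' m"
    and "continuous_on {0..1} \<phi>" "e > 0"
  obtains N where "\<And>n n'. n \<ge> N \<Longrightarrow> n' \<ge> N \<Longrightarrow> \<bar>wsum W T n \<phi> - wsum W' T' n' \<phi>\<bar> < e"
proof -
  have ev_bound: "\<forall>\<^sub>F n in sequentially. wsum V S n (\<lambda>t. 1) < m 0 + 1"
    if "has_limit_moments V S m" for V S
  proof -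
    have "(\<lambda>n. wsum V S n (\<lambda>t. t ^ 0)) \<longlonglongrightarrow> m 0"
      using that by (simp add: has_limit_moments_def del: power_0)
    thus ?thesis by (auto dest!: order_tendstoD(2)[where a = "m 0 + 1"])
  qed
  define C where "C = max 1 (m 0 + 1)"
  have C: "C \<ge> 1" by (simp add: C_def)
  obtain g where "real_polynomial_function g" and g: "\<And>t. t \<in> {0..1} \<Longrightarrow> \<bar>\<phi> t - g t\<bar> < e / (4 * C)"
    using Stone_Weierstrass_real_polynomial_function[of "{0..1::real}" \<phi> "e / (4 * C)"] assms(3,4) C
    by auto
  then obtain a d where g_eq: "g = (\<lambda>t. \<Sum>k\<le>d. a k * t ^ k)"
    by (auto simp: real_polynomial_function_iff_sum)
  have ev: "\<forall>\<^sub>F n in sequentially. \<bar>wsum V S n \<phi> - (\<Sum>k\<le>d. a k * m k)\<bar> < e / 2"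
    if V: "has_limit_moments V S m" for V S
  proof -
    have "\<forall>\<^sub>F n in sequentially. \<bar>wsum V S n g - (\<Sum>k\<le>d. a k * m k)\<bar> < e / 4"
      using tendstoD[OF wsum_polynomial_tendsto[OF V, where a = a and d = d], of "e / 4"] assms(4)
      by (simp add: g_eq dist_real_def)
    with ev_bound[OF V] show ?thesis
    proof eventually_elim
      case (elim n)
      have "\<bar>wsum V S n \<phi> - wsum V S n g\<bar> \<le> e / (4 * C) * wsum V S n (\<lambda>t. 1)"
        by (intro wsum_diff_bound[OF V] less_imp_le g) auto
      also have "\<dots> \<le> e / (4 * C) * C"
        using elim C assms(4) by (intro mult_left_mono) (auto simp: C_def)
      also have "\<dots> = e / 4" using C by simp
      finally show ?case using elim by linarith
    qed
  qed
  have "\<forall>\<^sub>F n in sequentially. \<bar>wsum W T n \<phi> - (\<Sum>k\<le>d. a k * m k)\<bar> < e / 2 \<and>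
          \<bar>wsum W' T' n \<phi> - (\<Sum>k\<le>d. a k * m k)\<bar> < e / 2"
    by (intro eventually_conj ev assms)
  then obtain N where N: "\<And>n. n \<ge> N \<Longrightarrow> \<bar>wsum W T n \<phi> - (\<Sum>k\<le>d. a k * m k)\<bar> < e / 2 \<and>
          \<bar>wsum W' T' n \<phi> - (\<Sum>k\<le>d. a k * m k)\<bar> < e / 2"
    unfolding eventually_sequentially by auto
  show ?thesis
  proof (rule that)
    fix n n' assume "n \<ge> N" "n' \<ge> N"
    with N[of n] N[of n'] show "\<bar>wsum W T n \<phi> - wsum W' T' n' \<phi>\<bar> < e" by linarith
  qed
qed

lemma wsum_convergent:
  assumes "has_limit_moments W T m" "continuous_on {0..1} \<phi>"
  shows "convergent (\<lambda>n. wsum W T n \<phi>)"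
proof -
  have "Cauchy (\<lambda>n. wsum W T n \<phi>)"
  proof (rule metric_CauchyI)
    fix e :: real assume "e > 0"
    from equal_moments_imp_close[OF assms(1,1,2) this]
    show "\<exists>M. \<forall>i\<ge>M. \<forall>n\<ge>M. dist (wsum W T i \<phi>) (wsum W T n \<phi>) < e"
      by (metis dist_real_def)
  qed
  thus ?thesis by (rule Cauchy_convergent)
qed

lemma wsum_same_limit:
  assumes "has_limit_moments W T m" "has_limit_moments W' T' m" "continuous_on {0..1} \<phi>"
    and "(\<lambda>n. wsum W' T' n \<phi>) \<longlonglongrightarrow> L"
  shows "(\<lambda>n. wsum W T n \<phi>) \<longlonglongrightarrow> L"
proof -
  have "(\<lambda>n. wsum W T n \<phi> - wsum W' T' n \<phi>) \<longlonglongrightarrow> 0"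
  proof (rule LIMSEQ_I)
    fix e :: real assume "e > 0"
    from equal_moments_imp_close[OF assms(1-3) this]
    show "\<exists>no. \<forall>n\<ge>no. norm (wsum W T n \<phi> - wsum W' T' n \<phi> - 0) < e"
      by (metis diff_zero real_norm_def)
  qed
  from tendsto_add[OF this assms(4)] show ?thesis by simp
qed

text \<open>
  If \<open>f (s0 + s)\<close> is the integral of \<open>t powr (s / h)\<close> against a measure, this is the integral of the
  \<open>i\<close>-th Bernstein polynomial of degree \<open>n\<close>.
\<close>

definition hausdorff_weight :: "real \<Rightarrow> real \<Rightarrow> (real \<Rightarrow> real) \<Rightarrow> nat \<Rightarrow> nat \<Rightarrow> real" where
  "hausdorff_weight h s0 f n i = real (n choose i) * bdiff h (n - i) f (s0 + real i * h)"

lemma hausdorff_weight_falling_moment: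
  assumes "k \<le> n"
  shows "(\<Sum>i\<le>n. hausdorff_weight h s0 f n i * (\<Prod>j<k. (real i - real j) / (real n - real j)))
         = f (s0 + real k * h)"
proof -
  have "(\<Sum>i\<le>n. hausdorff_weight h s0 f n i * (\<Prod>j<k. (real i - real j) / (real n - real j)))
      = (\<Sum>i\<le>n. (if k \<le> i then real (n - k choose (i - k)) * bdiff h (n - i) f (s0 + real i * h) else 0))"
  proof (rule sum.cong)
    fix i assume "i \<in> {..n}"
    hence "i \<le> n" by simp
    from binomial_falling_ratio[OF assms this]
    show "hausdorff_weight h s0 f n i * (\<Prod>j<k. (real i - real j) / (real n - real j))
        = (if k \<le> i then real (n - k choose (i - k)) * bdiff h (n - i) f (s0 + real i * h) else 0)"
      unfolding hausdorff_weight_def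
      by (subst mult.assoc, subst mult.left_commute, subst mult.commute) (auto simp: mult_ac)
  qed auto
  also have "\<dots> = (\<Sum>i\<in>{k..n}. real (n - k choose (i - k)) * bdiff h (n - i) f (s0 + real i * h))"
    by (rule sum.mono_neutral_cong_right) auto
  also have "\<dots> = (\<Sum>i\<le>n - k. real (n - k choose i) * bdiff h (n - k - i) f (s0 + real k * h + real i * h))"
    by (rule sum.reindex_bij_witness[of _ "\<lambda>i. i + k" "\<lambda>i. i - k"])
       (use assms in \<open>auto simp: of_nat_diff algebra_simps\<close>)
  also have "\<dots> = f (s0 + real k * h)" by (rule bdiff_binomial_sum)
  finally show ?thesis .
qed

text \<open>
  The weights reproduce the moments exactly if \<open>(i / n) ^ k\<close> is replaced by the ratio of falling
  factorials, and the two differ by \<open>O(1 / n)\<close> uniformly in \<open>i\<close>.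
\<close>

lemma hausdorff_weight_moments:
  assumes "completely_monotone_from s0 f" "h > 0"
  shows "has_limit_moments (hausdorff_weight h s0 f) (\<lambda>n i. real i / real n) (\<lambda>k. f (s0 + real k * h))"
proof -
  let ?W = "hausdorff_weight h s0 f"
  have W: "?W n i \<ge> 0" for n i
    using assms by (auto simp: hausdorff_weight_def completely_monotone_from_def)
  have tot: "(\<Sum>i\<le>n. ?W n i) = f s0" for n
    using hausdorff_weight_falling_moment[of 0 n h s0 f] by simp
  have "(\<lambda>n. wsum ?W (\<lambda>n i. real i / real n) n (\<lambda>t. t ^ k)) \<longlonglongrightarrow> f (s0 + real k * h)" for k
  proof -
    define r where "r = (\<lambda>n i j. (real i - real j) / (real n - real j))"
    \<comment> \<open>Beyond \<open>2 * k\<close> all factors \<open>r n i j\<close> have modulus at most \<open>1\<close>, also when \<open>i < j\<close>.\<close>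
    have bound: "\<bar>wsum ?W (\<lambda>n i. real i / real n) n (\<lambda>t. t ^ k) - f (s0 + real k * h)\<bar>
        \<le> f s0 * (real k * (real k / (real n - real k)))" if n: "n \<ge> 2 * k + 1" for n
    proof -
      have power_near: "\<bar>(real i / real n) ^ k - (\<Prod>j<k. r n i j)\<bar> \<le> real k * (real k / (real n - real k))"
        if i: "i \<le> n" for i
      proof -
        have "\<bar>(\<Prod>j<k. real i / real n) - (\<Prod>j<k. r n i j)\<bar> \<le> (\<Sum>j<k. \<bar>real i / real n - r n i j\<bar>)"
        proof -
          have "norm ((\<Prod>j<k. real i / real n) - (\<Prod>j<k. r n i j)) \<le> (\<Sum>j<k. norm (real i / real n - r n i j))"
          proof (rule norm_prod_diff)
            show "norm (real i / real n) \<le> 1" using i n by simp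
            fix j assume j: "j \<in> {..<k}"
            have "\<bar>real i - real j\<bar> \<le> real n - real j" using i j n by auto
            thus "norm (r n i j) \<le> 1" using j n by (simp add: r_def abs_divide field_simps)
          qed
          thus ?thesis by simp
        qed
        also have "\<dots> \<le> (\<Sum>j<k. real k / (real n - real k))"
        proof (rule sum_mono)
          fix j assume j: "j \<in> {..<k}"
          have pos: "real n > 0" "real n - real j > 0" "real n - real k > 0" using j n by auto
          have "real i / real n - r n i j = real j * (real n - real i) / (real n * (real n - real j))"
            using pos by (simp add: r_def divide_simps) (simp add: algebra_simps)
          also have "\<bar>\<dots>\<bar> = real j * ((real n - real i) / real n) / (real n - real j)"
            using pos i by (simp add: abs_mult)
          also have "\<dots> \<le> real k * 1 / (real n - real k)"
            using pos i j by (intro frac_le mult_mono) auto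
          finally show "\<bar>real i / real n - r n i j\<bar> \<le> real k / (real n - real k)" by simp
        qed
        finally show ?thesis by simp
      qed
      have "wsum ?W (\<lambda>n i. real i / real n) n (\<lambda>t. t ^ k) - f (s0 + real k * h)
          = (\<Sum>i\<le>n. ?W n i * ((real i / real n) ^ k - (\<Prod>j<k. r n i j)))"
        using n by (subst hausdorff_weight_falling_moment[of k n h s0 f, symmetric])
                   (auto simp: wsum_def r_def right_diff_distrib sum_subtractf)
      also have "\<bar>\<dots>\<bar> \<le> (\<Sum>i\<le>n. ?W n i * (real k * (real k / (real n - real k))))"
      proof (intro order_trans[OF sum_abs] sum_mono)
        fix i assume "i \<in> {..n}"
        thus "\<bar>?W n i * ((real i / real n) ^ k - (\<Prod>j<k. r n i j))\<bar>
            \<le> ?W n i * (real k * (real k / (real n - real k)))"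
          unfolding abs_mult abs_of_nonneg[OF W] by (intro mult_left_mono power_near W) simp
      qed
      also have "\<dots> = f s0 * (real k * (real k / (real n - real k)))"
        by (simp only: sum_distrib_right[symmetric] tot)
      finally show ?thesis .
    qed
    have "(\<lambda>n. f s0 * (real k * (real k / (real n - real k)))) \<longlonglongrightarrow> 0" by real_asymp
    hence "(\<lambda>n. wsum ?W (\<lambda>n i. real i / real n) n (\<lambda>t. t ^ k) - f (s0 + real k * h)) \<longlonglongrightarrow> 0"
      by (rule Lim_null_comparison[rotated], intro eventually_mono[OF eventually_ge_at_top[of "2 * k + 1"]])
         (unfold real_norm_def, rule bound)
    thus ?thesis by (simp add: LIM_zero_iff)
  qed
  thus ?thesis using W by (auto simp: has_limit_moments_def divide_le_eq_1)
qed

text \<open>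
  The weights with step \<open>1\<close> are built from the values of \<open>f\<close> at integer distance from \<open>s0\<close> only, so it
  is not clear that their fractional moments are values of \<open>f\<close>.  But the weights with step \<open>1 / N\<close>, moved to
  the points \<open>(i / n) ^ N\<close>, have the same limiting integer moments, hence the same limits for all continuous
  functions; for them the moment of order \<open>k / N\<close> is an ordinary one.
\<close>

lemma hausdorff_weight_rational_power:
  assumes "completely_monotone_from s0 f" "k > 0" "N > 0"
  shows "(\<lambda>n. wsum (hausdorff_weight 1 s0 f) (\<lambda>n i. real i / real n) n (\<lambda>t. t powr (real k / real N)))
           \<longlonglongrightarrow> f (s0 + real k / real N)"
proof (rule wsum_same_limit)
  let ?W = "hausdorff_weight (1 / real N) s0 f" and ?T = "\<lambda>n i. real i / real n"
  note fine = hausdorff_weight_moments[OF assms(1), of "1 / real N"]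
  show "has_limit_moments (hausdorff_weight 1 s0 f) ?T (\<lambda>j. f (s0 + real j))"
    using hausdorff_weight_moments[OF assms(1), of 1] by simp
  have eq: "(\<lambda>n. wsum ?W (\<lambda>n i. ?T n i ^ N) n (\<lambda>t. t ^ j)) = (\<lambda>n. wsum ?W ?T n (\<lambda>t. t ^ (N * j)))" for j
    by (simp add: wsum_def power_mult)
  have fine': "(\<lambda>n. wsum ?W ?T n (\<lambda>t. t ^ j)) \<longlonglongrightarrow> f (s0 + real j * (1 / real N))" for j
    using fine assms(3) by (auto simp: has_limit_moments_def)
  show "has_limit_moments ?W (\<lambda>n i. ?T n i ^ N) (\<lambda>j. f (s0 + real j))"
    unfolding has_limit_moments_def eq
  proof (intro conjI allI impI)
    fix j show "(\<lambda>n. wsum ?W ?T n (\<lambda>t. t ^ (N * j))) \<longlonglongrightarrow> f (s0 + real j)"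
      using fine'[of "N * j"] assms(3) by simp
  qed (use fine assms(3) in \<open>auto simp: has_limit_moments_def power_le_one\<close>)
  have "((real i / real n) ^ N) powr (real k / real N) = (real i / real n) ^ k" for i n
  proof (cases "real i / real n = 0")
    case True
    thus ?thesis unfolding True using assms by (simp add: power_0_left)
  next
    case False
    hence pos: "real i / real n > 0" by (simp add: zero_less_divide_iff)
    have "((real i / real n) ^ N) powr (real k / real N) = (real i / real n) powr (real N * (real k / real N))"
      using pos by (simp add: powr_powr powr_realpow[symmetric])
    thus ?thesis using pos assms(3) by (simp add: powr_realpow)
  qed
  hence "(\<lambda>n. wsum ?W (\<lambda>n i. ?T n i ^ N) n (\<lambda>t. t powr (real k / real N))) = (\<lambda>n. wsum ?W ?T n (\<lambda>t. t ^ k))"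
    by (simp add: wsum_def)
  thus "(\<lambda>n. wsum ?W (\<lambda>n i. ?T n i ^ N) n (\<lambda>t. t powr (real k / real N))) \<longlonglongrightarrow> f (s0 + real k / real N)"
    using fine'[of k] by simp
  show "continuous_on {0..1} (\<lambda>t. t powr (real k / real N))"
    using assms by (intro continuous_on_powr' continuous_intros) auto
qed

text \<open>
  Real exponents lie between rational ones, and \<open>t powr r\<close> decreases in \<open>r\<close> on \<open>{0..1}\<close>; the limits are
  therefore squeezed between values of the continuous function \<open>f\<close>.
\<close>

lemma hausdorff_weight_powr:
  assumes "completely_monotone_from s0 f" "r > 0" "isCont f (s0 + r)"
  shows "(\<lambda>n. wsum (hausdorff_weight 1 s0 f) (\<lambda>n i. real i / real n) n (\<lambda>t. t powr r))
           \<longlonglongrightarrow> f (s0 + r)"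
proof -
  let ?E = "wsum (hausdorff_weight 1 s0 f) (\<lambda>n i. real i / real n)"
  note sys = hausdorff_weight_moments[OF assms(1) zero_less_one]
  have "continuous_on {0..1} (\<lambda>t. t powr r)"
    using assms by (intro continuous_on_powr' continuous_intros) auto
  then obtain L where L: "(\<lambda>n. ?E n (\<lambda>t. t powr r)) \<longlonglongrightarrow> L"
    using wsum_convergent[OF sys] by (auto simp: convergent_def)
  have anti: "?E n (\<lambda>t. t powr b) \<le> ?E n (\<lambda>t. t powr a)" if "a \<le> b" "a > 0" for a b n
    unfolding wsum_def
  proof (intro sum_mono mult_left_mono)
    fix i assume "i \<in> {..n}"
    thus "(real i / real n) powr b \<le> (real i / real n) powr a" "0 \<le> hausdorff_weight 1 s0 f n i"
      using sys that by (cases "i = 0"; auto simp: has_limit_moments_def divide_le_eq_1 intro!: powr_mono')+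
  qed
  have rat: "(\<lambda>n. ?E n (\<lambda>t. t powr q)) \<longlonglongrightarrow> f (s0 + q)" if q: "q \<in> \<rat>" "q > 0" for q
  proof -
    from Rats_cases'[OF q(1)] obtain a b :: int where "b > 0" "q = of_int a / of_int b" by metis
    hence "a > 0" using q(2) by (simp add: zero_less_divide_iff)
    with \<open>b > 0\<close> \<open>q = _\<close> have q_eq: "q = real (nat a) / real (nat b)" by simp
    show ?thesis unfolding q_eq
      by (rule hausdorff_weight_rational_power[OF assms(1)]) (use \<open>a > 0\<close> \<open>b > 0\<close> in auto)
  qed
  have below: "L \<le> f (s0 + q)" if "q \<in> \<rat>" "q > 0" "q < r" for q
    by (rule LIMSEQ_le[OF L rat]) (use that anti[of q r] in auto)
  have above: "f (s0 + q) \<le> L" if "q \<in> \<rat>" "q > r" for q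
    by (rule LIMSEQ_le[OF rat L]) (use that anti[of r q] \<open>r > 0\<close> in auto)
  have "isCont (\<lambda>y. s0 + y) r" by simp
  from isCont_o2[OF this, where g = f] assms(3)
  have "isCont (\<lambda>y. f (s0 + y)) r" by simp
  hence cont: "((\<lambda>y. f (s0 + y)) \<longlongrightarrow> f (s0 + r)) (at r)" by (simp add: isCont_def)
  have "\<not> f (s0 + r) < L"
  proof
    assume "f (s0 + r) < L"
    from order_tendstoD(2)[OF cont this] obtain d where "d > 0" and
      d: "\<And>y. y \<noteq> r \<Longrightarrow> dist y r < d \<Longrightarrow> f (s0 + y) < L" by (auto simp: eventually_at)
    obtain q where q: "q \<in> \<rat>" "max 0 (r - d) < q" "q < r"
      using Rats_dense_in_real[of "max 0 (r - d)" r] \<open>d > 0\<close> assms(2) by auto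
    with d[of q] below[of q] show False by (auto simp: dist_real_def)
  qed
  moreover have "\<not> L < f (s0 + r)"
  proof
    assume "L < f (s0 + r)"
    from order_tendstoD(1)[OF cont this] obtain d where "d > 0" and
      d: "\<And>y. y \<noteq> r \<Longrightarrow> dist y r < d \<Longrightarrow> L < f (s0 + y)" by (auto simp: eventually_at)
    obtain q where q: "q \<in> \<rat>" "r < q" "q < r + d"
      using Rats_dense_in_real[of r "r + d"] \<open>d > 0\<close> by auto
    with d[of q] above[of q] show False by (auto simp: dist_real_def)
  qed
  ultimately show ?thesis using L by (simp add: not_less antisym)
qed

lemma completely_monotone_discrete_approx:
  assumes cm: "completely_monotone_from s0 f" and cont: "\<And>s. s > s0 \<Longrightarrow> isCont f s"
  obtains W :: "nat \<Rightarrow> nat \<Rightarrow> real" where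
    "\<And>n i. i \<le> n \<Longrightarrow> W n i \<ge> 0"
    "\<And>n. (\<Sum>i\<le>n. W n i) = f s0"
    "\<And>\<phi> :: real \<Rightarrow> real. continuous_on {0..1} \<phi> \<Longrightarrow> convergent (\<lambda>n. \<Sum>i\<le>n. W n i * \<phi> (real i / real n))"
    "\<And>r. r > 0 \<Longrightarrow> (\<lambda>n. \<Sum>i\<le>n. W n i * (real i / real n) powr r) \<longlonglongrightarrow> f (s0 + r)"
proof (rule that[of "hausdorff_weight 1 s0 f"])
  note sys = hausdorff_weight_moments[OF cm zero_less_one]
  show "hausdorff_weight 1 s0 f n i \<ge> 0" if "i \<le> n" for n i
    using sys that by (auto simp: has_limit_moments_def)
  show "(\<Sum>i\<le>n. hausdorff_weight 1 s0 f n i) = f s0" for n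
    using hausdorff_weight_falling_moment[of 0 n 1 s0 f] by simp
  show "convergent (\<lambda>n. \<Sum>i\<le>n. hausdorff_weight 1 s0 f n i * \<phi> (real i / real n))"
    if "continuous_on {0..1} \<phi>" for \<phi> :: "real \<Rightarrow> real"
    using wsum_convergent[OF sys that] by (simp add: wsum_def)
  show "(\<lambda>n. \<Sum>i\<le>n. hausdorff_weight 1 s0 f n i * (real i / real n) powr r) \<longlonglongrightarrow> f (s0 + r)"
    if "r > 0" for r
    using hausdorff_weight_powr[OF cm that cont] that by (simp add: wsum_def)
qed

section \<open>Quotients of Gamma products as moment functions\<close>

definition Gamma_ratio :: "real list \<Rightarrow> real list \<Rightarrow> real \<Rightarrow> real" where
  "Gamma_ratio as bs s = Gamma_prod (shift s as) / Gamma_prod (shift s bs)"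

lemma Gamma_prod_shift: "Gamma_prod (shift s as) = (\<Prod>j<length as. Gamma (as ! j + s))"
  by (induction as) (simp_all add: Gamma_prod_def shift_def prod.lessThan_Suc_shift del: prod.lessThan_Suc)

lemma Gamma_prod_shift_pos:
  "(\<And>a. a \<in> set as \<Longrightarrow> a + s > 0) \<Longrightarrow> Gamma_prod (shift s as) > 0"
  by (auto simp: Gamma_prod_shift intro!: prod_pos)

lemma Gamma_ratio_pos:
  assumes "\<And>a. a \<in> set as \<union> set bs \<Longrightarrow> a + s > 0"
  shows "Gamma_ratio as bs s > 0"
  using assms by (auto simp: Gamma_ratio_def intro!: divide_pos_pos Gamma_prod_shift_pos)

lemma pos_not_nonpos_Int: "(x::real) > 0 \<Longrightarrow> x \<notin> \<int>\<^sub>\<le>\<^sub>0"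
  by (auto dest: nonpos_Ints_nonpos)

lemma isCont_Gamma_ratio:
  assumes "\<And>a. a \<in> set as \<union> set bs \<Longrightarrow> a + s > 0"
  shows "isCont (Gamma_ratio as bs) s"
proof -
  have "isCont (\<lambda>s. Gamma_prod (shift s cs)) s" if "\<And>a. a \<in> set cs \<Longrightarrow> a + s > 0" for cs
    unfolding Gamma_prod_shift isCont_def
    by (intro tendsto_prod tendsto_Gamma tendsto_intros pos_not_nonpos_Int) (use that in auto)
  moreover have "Gamma_prod (shift s bs) \<noteq> 0"
    using assms by (intro less_imp_neq[THEN not_sym] Gamma_prod_shift_pos) auto
  ultimately have "isCont (\<lambda>s. Gamma_prod (shift s as) / Gamma_prod (shift s bs)) s"
    using assms by (intro continuous_intros) auto
  thus ?thesis unfolding Gamma_ratio_def .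
qed

text \<open>
  The negative derivative of the logarithm is \<open>1 / (a + s) - 1 / (b + s)\<close>, summed over the components,
  and this is the Mellin transform of \<open>v_fun as bs\<close>.  Here the sign condition on \<open>v_fun\<close> enters.
\<close>

lemma completely_monotone_ln_ratio:
  assumes len: "length as = length bs"
    and pos: "\<And>a. a \<in> set as \<union> set bs \<Longrightarrow> a + s0 > 0"
    and v: "\<And>t. 0 \<le> t \<Longrightarrow> t \<le> 1 \<Longrightarrow> v_fun as bs t \<ge> 0"
  shows "completely_monotone_from s0 (\<lambda>s. \<Sum>j<length as. ln (bs ! j + s) - ln (as ! j + s))"
proof (rule completely_monotone_from_derivative[where w = "v_fun as bs"])
  fix s assume s: "s \<ge> s0"
  have p: "as ! j + s > 0" "bs ! j + s > 0" if "j < length as" for j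
    using pos[of "as ! j"] pos[of "bs ! j"] that len s by (auto simp: nth_mem)
  show "((\<lambda>s. \<Sum>j<length as. ln (bs ! j + s) - ln (as ! j + s)) has_real_derivative
         - (\<Sum>j<length as. 1 / (as ! j + s) - 1 / (bs ! j + s))) (at s)"
    unfolding sum_negf[symmetric]
    by (intro DERIV_sum) (use p in \<open>auto intro!: derivative_eq_intros simp: field_simps\<close>)
  have int: "((\<lambda>t. t powr (s - 1) * t powr c) has_integral 1 / (c + s)) {0..1}" if "c + s > 0" for c :: real
  proof -
    have "((\<lambda>t::real. t powr (c + s - 1)) has_integral 1 powr (c + s - 1 + 1) / (c + s - 1 + 1)) {0..1}"
      using that by (intro has_integral_powr_from_0) auto
    thus ?thesis by (simp add: powr_add[symmetric] algebra_simps)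
  qed
  have "((\<lambda>t. \<Sum>j<length as. t powr (s - 1) * t powr (as ! j) - t powr (s - 1) * t powr (bs ! j))
         has_integral (\<Sum>j<length as. 1 / (as ! j + s) - 1 / (bs ! j + s))) {0..1}"
    by (intro has_integral_sum has_integral_diff int) (use p in auto)
  thus "((\<lambda>t. t powr (s - 1) * v_fun as bs t)
         has_integral (\<Sum>j<length as. 1 / (as ! j + s) - 1 / (bs ! j + s))) {0..1}"
    by (simp add: v_fun_def sum_distrib_left right_diff_distrib)
next
  have "((\<lambda>s. ln (b + s) - ln (a + s)) \<longlongrightarrow> 0) at_top" for a b :: real
    by real_asymp
  hence "((\<lambda>s. \<Sum>j<length as. ln (bs ! j + s) - ln (as ! j + s)) \<longlongrightarrow> (\<Sum>j<length as. 0)) at_top"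
    by (intro tendsto_sum)
  thus "((\<lambda>s. \<Sum>j<length as. ln (bs ! j + s) - ln (as ! j + s)) \<longlongrightarrow> 0) at_top" by simp
qed (use v in auto)

text \<open>
  By Euler's product, \<open>\<Gamma>(a + s) / \<Gamma>(b + s)\<close> is the limit of \<open>n powr (a - b)\<close> times the product of the
  factors \<open>(b + s + k) / (a + s + k)\<close> over \<open>k \<le> n\<close>.  The product over all components is, for each \<open>k\<close>,
  the exponential of a shifted copy of the logarithm treated above.
\<close>

lemma completely_monotone_Gamma_ratio:
  assumes len: "length as = length bs"
    and pos: "\<And>a. a \<in> set as \<union> set bs \<Longrightarrow> a + s0 > 0"
    and v: "\<And>t. 0 \<le> t \<Longrightarrow> t \<le> 1 \<Longrightarrow> v_fun as bs t \<ge> 0"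
  shows "completely_monotone_from s0 (Gamma_ratio as bs)"
proof -
  define L where "L = (\<lambda>s. \<Sum>j<length as. ln (bs ! j + s) - ln (as ! j + s))"
  define A where "A = (\<Sum>j<length as. as ! j - bs ! j)"
  show ?thesis
  proof (rule completely_monotone_limit)
    fix n :: nat
    show "completely_monotone_from s0 (\<lambda>s. exp (ln (real n) * A) * (\<Prod>k\<le>n. exp (L (s + real k))))"
      unfolding L_def using assms
      by (intro completely_monotone_mult completely_monotone_const completely_monotone_prod
          completely_monotone_shift completely_monotone_exp completely_monotone_ln_ratio) auto
  next
    fix s assume s: "s \<ge> s0"
    have p: "as ! j + s > 0" "bs ! j + s > 0" if "j < length as" for j
      using pos[of "as ! j"] pos[of "bs ! j"] that len s by (auto simp: nth_mem)
    have eq: "(\<Prod>j<length as. Gamma_series (as ! j + s) n) / (\<Prod>j<length as. Gamma_series (bs ! j + s) n)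
        = exp (ln (real n) * A) * (\<Prod>k\<le>n. exp (L (s + real k)))" for n
    proof -
      have "(\<Prod>k\<le>n. exp (L (s + real k)))
          = (\<Prod>k\<le>n. \<Prod>j<length as. (bs ! j + s + real k) / (as ! j + s + real k))"
        unfolding L_def by (intro prod.cong refl)
          (use p in \<open>force simp: exp_sum exp_diff add_ac add_pos_nonneg intro!: prod.cong\<close>)
      also have "\<dots> = (\<Prod>j<length as. pochhammer (bs ! j + s) (Suc n) / pochhammer (as ! j + s) (Suc n))"
        by (subst prod.swap) (simp add: pochhammer_Suc_prod prod_dividef lessThan_Suc_atMost atLeast0AtMost)
      finally have P: "(\<Prod>k\<le>n. exp (L (s + real k)))
          = (\<Prod>j<length as. pochhammer (bs ! j + s) (Suc n) / pochhammer (as ! j + s) (Suc n))" .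
      have "(\<Prod>j<length as. Gamma_series (as ! j + s) n) / (\<Prod>j<length as. Gamma_series (bs ! j + s) n)
          = (\<Prod>j<length as. exp (ln (real n) * (as ! j - bs ! j)) *
               (pochhammer (bs ! j + s) (Suc n) / pochhammer (as ! j + s) (Suc n)))"
        unfolding prod_dividef[symmetric]
      proof (intro prod.cong refl)
        fix j assume "j \<in> {..<length as}"
        have "exp (ln (real n) * (as ! j - bs ! j))
            = exp ((as ! j + s) * ln (real n)) / exp ((bs ! j + s) * ln (real n))"
          by (simp add: exp_diff[symmetric] algebra_simps)
        thus "Gamma_series (as ! j + s) n / Gamma_series (bs ! j + s) n =
          exp (ln (real n) * (as ! j - bs ! j)) *
               (pochhammer (bs ! j + s) (Suc n) / pochhammer (as ! j + s) (Suc n))"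
          by (simp add: Gamma_series_def)
      qed
      also have "\<dots> = exp (ln (real n) * A) * (\<Prod>k\<le>n. exp (L (s + real k)))"
        unfolding prod.distrib P by (simp add: A_def exp_sum sum_distrib_left)
      finally show ?thesis .
    qed
    have "(\<lambda>n. (\<Prod>j<length as. Gamma_series (as ! j + s) n) / (\<Prod>j<length as. Gamma_series (bs ! j + s) n))
        \<longlonglongrightarrow> (\<Prod>j<length as. Gamma (as ! j + s)) / (\<Prod>j<length as. Gamma (bs ! j + s))"
      by (intro tendsto_divide tendsto_prod Gamma_series_LIMSEQ)
         (use p in \<open>auto simp: Gamma_eq_zero_iff dest!: pos_not_nonpos_Int\<close>)
    thus "(\<lambda>n. exp (ln (real n) * A) * (\<Prod>k\<le>n. exp (L (s + real k)))) \<longlonglongrightarrow> Gamma_ratio as bs s"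
      unfolding eq by (simp add: Gamma_ratio_def Gamma_prod_shift len)
  qed
qed

text \<open>
  As \<open>t\<close> tends to \<open>0\<close> the positive powers vanish, while an exponent \<open>b \<le> 0\<close> would contribute at least \<open>1\<close>
  with a negative sign.
\<close>

lemma v_fun_nonneg_imp_pos:
  assumes len: "length as = length bs"
    and a: "\<And>a. a \<in> set as \<Longrightarrow> a > 0" and b: "0 \<notin> set bs"
    and v: "\<And>t. 0 \<le> t \<Longrightarrow> t \<le> 1 \<Longrightarrow> v_fun as bs t \<ge> 0"
    and mem: "b \<in> set bs"
  shows "b > 0"
proof (rule ccontr)
  assume "\<not> b > 0"
  hence b0: "b \<le> 0" by simp
  obtain i where i: "i < length bs" "bs ! i = b" using mem by (auto simp: in_set_conv_nth)
  have "((\<lambda>t. \<Sum>j<length as. t powr (as ! j)) \<longlongrightarrow> (\<Sum>j<length as. 0)) (at_right 0)"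
  proof (intro tendsto_sum)
    fix j assume "j \<in> {..<length as}"
    hence "as ! j > 0" using a by auto
    thus "((\<lambda>t. t powr (as ! j)) \<longlongrightarrow> 0) (at_right 0)" by real_asymp
  qed
  hence "\<forall>\<^sub>F t in at_right 0. (\<Sum>j<length as. t powr (as ! j)) < 1"
    by (intro order_tendstoD) auto
  moreover have "\<forall>\<^sub>F t in at_right (0::real). t \<in> {0<..<1}"
    by (rule eventually_at_right_real) simp
  ultimately have "\<forall>\<^sub>F t in at_right (0::real). False"
  proof eventually_elim
    case (elim t)
    have "t powr 0 \<le> t powr (bs ! i)" using elim b0 i by (intro powr_mono') auto
    hence "1 \<le> t powr (bs ! i)" using elim by simp
    also have "\<dots> \<le> (\<Sum>j<length as. t powr (bs ! j))"
      using i len by (intro member_le_sum) auto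
    finally have "v_fun as bs t < 0" using elim by (simp add: v_fun_def sum_subtractf)
    with v[of t] elim show ?case by simp
  qed
  thus False by simp
qed

text \<open>
  The mass \<open>W n i\<close> sits at \<open>i / n\<close>, and \<open>M s\<close> is the moment of order \<open>\<delta> + s\<close> of the limiting measure.
  The positive offset \<open>\<delta>\<close> makes \<open>t powr (\<delta> + s)\<close> continuous on \<open>{0..1}\<close> also for \<open>s = 0\<close>, where
  \<open>0 powr 0 = 0\<close> would cause a jump; it also means that the grid point \<open>0\<close> never contributes.
\<close>

definition moment_approx :: "real \<Rightarrow> (nat \<Rightarrow> nat \<Rightarrow> real) \<Rightarrow> (real \<Rightarrow> real) \<Rightarrow> bool" where
  "moment_approx \<delta> W M \<longleftrightarrow> \<delta> > 0 \<and> (\<forall>n. \<forall>i\<le>n. 0 \<le> W n i) \<and> (\<exists>C. \<forall>n. (\<Sum>i\<le>n. W n i) = C) \<and>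
     (\<forall>\<phi> :: real \<Rightarrow> real. continuous_on {0..1} \<phi> \<longrightarrow> convergent (\<lambda>n. \<Sum>i\<le>n. W n i * \<phi> (real i / real n))) \<and>
     (\<forall>s\<ge>0. (\<lambda>n. \<Sum>i\<le>n. W n i * (real i / real n) powr (\<delta> + s)) \<longlonglongrightarrow> M s)"

text \<open>
  All parameters exceed \<open>\<delta>\<close>, so that the quotient is still completely monotone from \<open>- \<delta>\<close> on.
\<close>

lemma Gamma_ratio_discrete_approx:
  assumes len: "length as = length bs"
    and a: "\<And>a. a \<in> set as \<Longrightarrow> a > 0" and b: "0 \<notin> set bs"
    and v: "\<And>t. 0 \<le> t \<Longrightarrow> t \<le> 1 \<Longrightarrow> v_fun as bs t \<ge> 0"
  obtains \<delta> W where "moment_approx \<delta> W (Gamma_ratio as bs)"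
proof -
  have pos: "c > 0" if "c \<in> set as \<union> set bs" for c
    using that a v_fun_nonneg_imp_pos[OF len a b v] by auto
  define \<delta> where "\<delta> = Min (insert 2 (set as \<union> set bs)) / 2"
  have \<delta>: "\<delta> > 0" using pos by (simp add: \<delta>_def)
  have \<delta>': "c + (- \<delta>) > 0" if "c \<in> set as \<union> set bs" for c
  proof -
    have "2 * \<delta> \<le> c" unfolding \<delta>_def using that by (simp add: Min_le)
    thus ?thesis using \<delta> by simp
  qed
  have cont: "isCont (Gamma_ratio as bs) s" if "s > - \<delta>" for s
    using \<delta>' that by (intro isCont_Gamma_ratio) force
  from completely_monotone_discrete_approx[OF completely_monotone_Gamma_ratio[OF len \<delta>' v] cont]
  obtain W :: "nat \<Rightarrow> nat \<Rightarrow> real" where W: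
    "\<And>n i. i \<le> n \<Longrightarrow> W n i \<ge> 0"
    "\<And>n. (\<Sum>i\<le>n. W n i) = Gamma_ratio as bs (- \<delta>)"
    "\<And>\<phi> :: real \<Rightarrow> real. continuous_on {0..1} \<phi> \<Longrightarrow> convergent (\<lambda>n. \<Sum>i\<le>n. W n i * \<phi> (real i / real n))"
    "\<And>r. r > 0 \<Longrightarrow> (\<lambda>n. \<Sum>i\<le>n. W n i * (real i / real n) powr r) \<longlonglongrightarrow> Gamma_ratio as bs (- \<delta> + r)"
    by blast
  have "moment_approx \<delta> W (Gamma_ratio as bs)"
    unfolding moment_approx_def using \<delta> W(1,2,3) W(4)[of "\<delta> + _"] by auto
  thus ?thesis by (rule that)
qed

section \<open>Multiplying power series coefficients by moments\<close>

lemma moment_approxE: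
  assumes "moment_approx \<delta> W M"
  obtains C where "\<delta> > 0" "\<And>n i. i \<le> n \<Longrightarrow> W n i \<ge> 0" "\<And>n. (\<Sum>i\<le>n. W n i) = C"
    "\<And>\<phi> :: real \<Rightarrow> real. continuous_on {0..1} \<phi> \<Longrightarrow> convergent (\<lambda>n. \<Sum>i\<le>n. W n i * \<phi> (real i / real n))"
    "\<And>s. s \<ge> 0 \<Longrightarrow> (\<lambda>n. \<Sum>i\<le>n. W n i * (real i / real n) powr (\<delta> + s)) \<longlonglongrightarrow> M s"
  using assms unfolding moment_approx_def by (elim conjE exE) (rule that, blast+)

lemma slit_plane_scale:
  assumes "z \<in> slit_plane" "0 \<le> t" "t \<le> 1"
  shows "z * of_real t \<in> slit_plane"
proof
  assume "z * of_real t \<in> complex_of_real ` {1..}"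
  then obtain r where r: "r \<ge> 1" "z * of_real t = of_real r" by auto
  hence "t \<noteq> 0" by auto
  hence z: "z = of_real (r / t)" using r by (simp add: field_simps)
  moreover have "r / t \<ge> 1" using r assms \<open>t \<noteq> 0\<close> by (simp add: field_simps)
  ultimately show False using assms(1) unfolding z by blast
qed

lemma open_slit_plane: "open slit_plane"
  by (intro open_Compl closed_slot_right)

lemma ball_subset_slit_plane: "ball 0 1 \<subseteq> slit_plane"
  by auto

text \<open>
  Inside the disk of absolute convergence, a sum over the grid of values of the power series with
  coefficients \<open>c\<close> converges to the power series with coefficients \<open>c k * M (\<mu> + k)\<close>, by Tannery's theorem:
  all approximate moments are bounded by the total mass.
\<close>

lemma moment_approx_series:
  fixes c :: "nat \<Rightarrow> real" and z :: complex
  assumes W: "moment_approx \<delta> W M" and \<mu>: "\<mu> \<ge> 0"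
    and summ: "summable (\<lambda>k. norm (of_real (c k) * z ^ k))"
  shows "summable (\<lambda>k. norm (of_real (c k * M (\<mu> + real k)) * z ^ k))" (is ?th1)
    and "(\<lambda>n. \<Sum>i\<le>n. of_real (W n i * (real i / real n) powr (\<delta> + \<mu>)) *
            (\<Sum>k. of_real (c k) * (z * of_real (real i / real n)) ^ k))
         \<longlonglongrightarrow> (\<Sum>k. of_real (c k * M (\<mu> + real k)) * z ^ k)" (is ?th2)
proof -
  from W obtain C where \<delta>: "\<delta> > 0" and W0: "\<And>n i. i \<le> n \<Longrightarrow> W n i \<ge> 0"
    and C: "\<And>n. (\<Sum>i\<le>n. W n i) = C"
    and lim: "\<And>s. s \<ge> 0 \<Longrightarrow> (\<lambda>n. \<Sum>i\<le>n. W n i * (real i / real n) powr (\<delta> + s)) \<longlonglongrightarrow> M s"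
    by (rule moment_approxE) blast
  define E where "E = (\<lambda>n k. \<Sum>i\<le>n. W n i * (real i / real n) powr (\<delta> + (\<mu> + real k)))"
  have unit: "0 \<le> real i / real n" "real i / real n \<le> 1" if "i \<le> n" for i n
    using that by (auto simp: divide_le_eq_1)
  have E_bound: "\<bar>E n k\<bar> \<le> C" for n k
  proof -
    have "\<bar>E n k\<bar> \<le> (\<Sum>i\<le>n. W n i * 1)" unfolding E_def
    proof (intro order_trans[OF sum_abs] sum_mono)
      fix i assume i: "i \<in> {..n}"
      show "\<bar>W n i * (real i / real n) powr (\<delta> + (\<mu> + real k))\<bar> \<le> W n i * 1"
        unfolding abs_mult using i W0[of i n] unit[of i n] \<delta> \<mu>
        by (intro mult_mono) (auto simp: powr_le1)
    qed
    thus ?thesis using C by simp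
  qed
  have powr_k: "(real i / real n) powr (\<delta> + \<mu>) * (real i / real n) ^ k
      = (real i / real n) powr (\<delta> + (\<mu> + real k))" for i n k
  proof (cases "real i / real n = 0")
    case True
    thus ?thesis unfolding True by simp
  next
    case False
    hence "real i / real n > 0" by (simp add: zero_less_divide_iff)
    thus ?thesis by (simp add: powr_add powr_realpow)
  qed
  have swap: "(\<Sum>i\<le>n. of_real (W n i * (real i / real n) powr (\<delta> + \<mu>)) *
                 (\<Sum>k. of_real (c k) * (z * of_real (real i / real n)) ^ k))
            = (\<Sum>k. of_real (c k * E n k) * z ^ k)" for n
  proof -
    have sm: "summable (\<lambda>k. of_real (c k) * (z * of_real (real i / real n)) ^ k)" if "i \<le> n" for i
    proof (rule summable_norm_cancel, rule summable_comparison_test'[OF summ, of 0])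
      fix k
      have "(real i / real n) ^ k \<le> 1" using unit[OF that] by (intro power_le_one) auto
      hence "norm (of_real (c k) * z ^ k) * (real i / real n) ^ k \<le> norm (of_real (c k) * z ^ k) * 1"
        by (intro mult_left_mono) auto
      moreover have "norm (of_real (c k) * (z * of_real (real i / real n)) ^ k)
          = norm (of_real (c k) * z ^ k) * (real i / real n) ^ k"
        unfolding power_mult_distrib norm_mult norm_power norm_of_real abs_of_nonneg[OF unit(1)[OF that]]
        by (rule mult.assoc[symmetric])
      ultimately show "norm (norm (of_real (c k) * (z * of_real (real i / real n)) ^ k)) \<le> norm (of_real (c k) * z ^ k)"
        by simp
    qed
    have "(\<Sum>i\<le>n. of_real (W n i * (real i / real n) powr (\<delta> + \<mu>)) *
                 (\<Sum>k. of_real (c k) * (z * of_real (real i / real n)) ^ k))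
       = (\<Sum>i\<le>n. \<Sum>k. of_real (W n i * (real i / real n) powr (\<delta> + \<mu>)) *
                 (of_real (c k) * (z * of_real (real i / real n)) ^ k))"
      by (intro sum.cong refl suminf_mult[symmetric] sm) auto
    also have "\<dots> = (\<Sum>k. \<Sum>i\<le>n. of_real (W n i * (real i / real n) powr (\<delta> + \<mu>)) *
                 (of_real (c k) * (z * of_real (real i / real n)) ^ k))"
      by (intro suminf_sum[symmetric] summable_mult sm) auto
    also have "\<dots> = (\<Sum>k. of_real (c k * E n k) * z ^ k)"
    proof (intro suminf_cong)
      fix k
      have "(\<Sum>i\<le>n. of_real (W n i * (real i / real n) powr (\<delta> + \<mu>)) *
                 (of_real (c k) * (z * of_real (real i / real n)) ^ k))
          = (\<Sum>i\<le>n. of_real (c k) * of_real (W n i * ((real i / real n) powr (\<delta> + \<mu>) * (real i / real n) ^ k)) * z ^ k)"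
        by (intro sum.cong refl) (simp only: power_mult_distrib of_real_mult of_real_power mult_ac)
      also have "\<dots> = of_real (c k * E n k) * z ^ k"
        unfolding powr_k E_def by (simp add: sum_distrib_left sum_distrib_right)
      finally show "(\<Sum>i\<le>n. of_real (W n i * (real i / real n) powr (\<delta> + \<mu>)) *
                 (of_real (c k) * (z * of_real (real i / real n)) ^ k)) = of_real (c k * E n k) * z ^ k" .
    qed
    finally show ?thesis .
  qed
  have "eventually (\<lambda>n. summable (\<lambda>k. norm (of_real (c k * E n k) * z ^ k))) sequentially \<and>
        summable (\<lambda>k. norm (of_real (c k * M (\<mu> + real k)) * z ^ k)) \<and>
        ((\<lambda>n. \<Sum>k. of_real (c k * E n k) * z ^ k) \<longlonglongrightarrow> (\<Sum>k. of_real (c k * M (\<mu> + real k)) * z ^ k))"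
  proof (rule tannerys_theorem)
    show "(\<lambda>n. of_real (c k * E n k) * z ^ k) \<longlonglongrightarrow> of_real (c k * M (\<mu> + real k)) * z ^ k" for k
      unfolding E_def using lim[of "\<mu> + real k"] \<mu> by (intro tendsto_intros) auto
    show "eventually (\<lambda>(k, n). norm (of_real (c k * E n k) * z ^ k) \<le> norm (of_real (c k) * z ^ k) * C)
            (at_top \<times>\<^sub>F sequentially)"
    proof (rule always_eventually, safe)
      fix k n
      have "norm (of_real (c k * E n k) * z ^ k) = norm (of_real (c k) * z ^ k) * \<bar>E n k\<bar>"
        by (simp add: norm_mult abs_mult)
      also have "\<dots> \<le> norm (of_real (c k) * z ^ k) * C"
        by (intro mult_left_mono E_bound) auto
      finally show "norm (of_real (c k * E n k) * z ^ k) \<le> norm (of_real (c k) * z ^ k) * C" .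
    qed
    show "summable (\<lambda>k. norm (of_real (c k) * z ^ k) * C)" by (intro summable_mult2 summ)
  qed simp
  thus ?th1 ?th2 unfolding swap by auto
qed

text \<open>
  \<open>G\<close> is the analytic continuation to the slit plane of the power series with real coefficients \<open>c\<close>.
\<close>

definition slit_sum :: "(nat \<Rightarrow> real) \<Rightarrow> (complex \<Rightarrow> complex) \<Rightarrow> bool" where
  "slit_sum c G \<longleftrightarrow> G holomorphic_on slit_plane \<and> (\<forall>z\<in>ball 0 1. (\<lambda>k. of_real (c k) * z ^ k) sums G z)"

lemma slit_sum_abs_summable:
  fixes z :: complex
  assumes "slit_sum c G" "norm z < 1"
  shows "summable (\<lambda>k. norm (of_real (c k) * z ^ k))"
proof -
  define w where "w = complex_of_real ((norm z + 1) / 2)"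
  have w: "norm w = (norm z + 1) / 2" by (simp add: w_def del: of_real_divide of_real_add)
  hence "w \<in> ball 0 1" using assms by simp
  hence "summable (\<lambda>k. of_real (c k) * w ^ k)"
    using assms by (auto simp: slit_sum_def sums_iff)
  thus ?thesis by (rule powser_insidea) (use w assms in auto)
qed

text \<open>
  Multiplication by moments preserves continuability to the slit plane.  The grid sums of the
  continuation \<open>G\<close> are holomorphic, because the slit plane is star-shaped about \<open>0\<close>, and locally bounded;
  Montel's theorem yields a holomorphic limit, whose power series is known from the unit disk.  The full
  sequence converges, not just a subsequence, because grid sums of continuous functions converge.
\<close>

lemma moment_approx_slit_plane:
  assumes W: "moment_approx \<delta> W M" and \<mu>: "\<mu> \<ge> 0" and G: "slit_sum c G"
  obtains H where "slit_sum (\<lambda>k. c k * M (\<mu> + real k)) H"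
    "\<And>z. z \<in> slit_plane \<Longrightarrow>
       (\<lambda>n. \<Sum>i\<le>n. of_real (W n i * (real i / real n) powr (\<delta> + \<mu>)) * G (z * of_real (real i / real n)))
       \<longlonglongrightarrow> H z"
proof -
  define F where "F = (\<lambda>n z. \<Sum>i\<le>n. of_real (W n i * (real i / real n) powr (\<delta> + \<mu>)) *
                              G (z * of_real (real i / real n)))"
  from W obtain C where \<delta>: "\<delta> > 0" and W0: "\<And>n i. i \<le> n \<Longrightarrow> W n i \<ge> 0"
    and C: "\<And>n. (\<Sum>i\<le>n. W n i) = C"
    and conv: "\<And>\<phi> :: real \<Rightarrow> real. continuous_on {0..1} \<phi> \<Longrightarrow> convergent (\<lambda>n. \<Sum>i\<le>n. W n i * \<phi> (real i / real n))"
    by (rule moment_approxE) blast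
  have unit: "0 \<le> real i / real n" "real i / real n \<le> 1" if "i \<le> n" for i n
    using that by (auto simp: divide_le_eq_1)
  have G_hol: "G holomorphic_on slit_plane"
    and G_sums: "\<And>z. z \<in> ball 0 1 \<Longrightarrow> (\<lambda>k. of_real (c k) * z ^ k) sums G z"
    using G by (auto simp: slit_sum_def)
  have G_scale: "(\<lambda>z. G (z * of_real t)) holomorphic_on slit_plane" if "0 \<le> t" "t \<le> 1" for t
  proof -
    have "G \<circ> (\<lambda>z. z * of_real t) holomorphic_on slit_plane"
      by (rule holomorphic_on_compose_gen[OF _ G_hol])
         (use slit_plane_scale[OF _ that] in \<open>auto intro!: holomorphic_intros\<close>)
    thus ?thesis by (simp add: o_def)
  qed
  have F_hol: "F n holomorphic_on slit_plane" for n
    unfolding F_def by (intro holomorphic_intros G_scale unit) auto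
  have F_bound: "\<exists>B. \<forall>h\<in>range F. \<forall>z\<in>K. norm (h z) \<le> B" if K: "compact K" "K \<subseteq> slit_plane" for K
  proof -
    \<comment> \<open>All arguments of \<open>G\<close> that occur for \<open>z \<in> K\<close> lie in one compact subset of the slit plane.\<close>
    let ?K = "(\<lambda>(z, t). z * complex_of_real t) ` (K \<times> {0..1})"
    have "compact ?K"
      by (intro compact_continuous_image compact_Times K)
         (auto simp: case_prod_unfold intro!: continuous_intros)
    moreover have "?K \<subseteq> slit_plane"
    proof
      fix w assume "w \<in> ?K"
      then obtain z t where zt: "z \<in> K" "0 \<le> t" "t \<le> 1" "w = z * of_real t" by auto
      show "w \<in> slit_plane"
        unfolding zt(4) by (rule slit_plane_scale[OF subsetD[OF K(2) zt(1)] zt(2,3)])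
    qed
    ultimately have "compact (G ` ?K)"
      by (rule compact_continuous_image[rotated,
            OF _ continuous_on_subset[OF holomorphic_on_imp_continuous_on[OF G_hol]]])
    from compact_imp_bounded[OF this] obtain B where B: "\<And>w. w \<in> G ` ?K \<Longrightarrow> norm w \<le> B"
      unfolding bounded_iff by blast
    have "norm (F n z) \<le> C * max 0 B" if z: "z \<in> K" for n z
    proof -
      have "norm (F n z) \<le> (\<Sum>i\<le>n. W n i * max 0 B)" unfolding F_def
      proof (intro order_trans[OF norm_sum] sum_mono)
        fix i assume i: "i \<in> {..n}"
        have "norm (G (z * of_real (real i / real n))) \<le> max 0 B"
          using z unit[of i n] i by (intro max.coboundedI2 B) (auto intro!: image_eqI[of _ _ "(z, real i / real n)"])
        moreover have "\<bar>W n i * (real i / real n) powr (\<delta> + \<mu>)\<bar> \<le> W n i"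
          using i W0[of i n] unit[of i n] \<delta> \<mu> by (auto simp: abs_mult intro!: mult_left_le powr_le1)
        ultimately show "norm (of_real (W n i * (real i / real n) powr (\<delta> + \<mu>)) *
            G (z * of_real (real i / real n))) \<le> W n i * max 0 B"
          unfolding norm_mult norm_of_real using i W0[of i n] by (intro mult_mono) auto
      qed
      thus ?thesis using C by (simp add: sum_distrib_right[symmetric])
    qed
    thus ?thesis by blast
  qed
  obtain H r where H_hol: "H holomorphic_on slit_plane" and r: "strict_mono r"
    and H_lim: "\<And>z. z \<in> slit_plane \<Longrightarrow> (\<lambda>n. F (r n) z) \<longlonglongrightarrow> H z"
  proof (rule Montel[OF open_slit_plane, of "range F" F])
    show "h holomorphic_on slit_plane" if "h \<in> range F" for h
      using that F_hol by fast
    show "\<exists>B. \<forall>h\<in>range F. \<forall>z\<in>K. norm (h z) \<le> B" if "compact K" "K \<subseteq> slit_plane" for K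
      by (rule F_bound[OF that])
    show "range F \<subseteq> range F" by (rule order_refl)
    fix H :: "complex \<Rightarrow> complex" and r :: "nat \<Rightarrow> nat"
    assume "H holomorphic_on slit_plane" "strict_mono r"
      and "\<And>z. z \<in> slit_plane \<Longrightarrow> (\<lambda>n. F (r n) z) \<longlonglongrightarrow> H z"
    thus thesis by (rule that)
  qed
  have F_lim: "(\<lambda>n. F n z) \<longlonglongrightarrow> H z" if z: "z \<in> slit_plane" for z
  proof -
    let ?\<phi> = "\<lambda>t. complex_of_real (t powr (\<delta> + \<mu>)) * G (z * of_real t)"
    have G_cont: "continuous_on {0..1} (\<lambda>t. G (z * of_real t))"
    proof (rule continuous_on_compose2[OF holomorphic_on_imp_continuous_on[OF G_hol]])
      show "(\<lambda>t. z * complex_of_real t) ` {0..1} \<subseteq> slit_plane"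
        by (rule image_subsetI, rule slit_plane_scale[OF z]) auto
    qed (intro continuous_intros)
    have powr_cont: "continuous_on {0..1} (\<lambda>t. t powr (\<delta> + \<mu>))"
      using \<delta> \<mu> by (intro continuous_on_powr' continuous_intros) auto
    have \<phi>_cont: "continuous_on {0..1} ?\<phi>"
      by (intro continuous_on_mult continuous_on_of_real powr_cont G_cont)
    have eq: "F n z = Complex (\<Sum>i\<le>n. W n i * Re (?\<phi> (real i / real n))) (\<Sum>i\<le>n. W n i * Im (?\<phi> (real i / real n)))" for n
      by (simp add: F_def complex_eq_iff mult_ac)
    have "convergent (\<lambda>n. F n z)"
    proof -
      from conv[OF continuous_on_Re[OF \<phi>_cont]] obtain a where "(\<lambda>n. \<Sum>i\<le>n. W n i * Re (?\<phi> (real i / real n))) \<longlonglongrightarrow> a"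
        unfolding convergent_def by (rule exE)
      moreover from conv[OF continuous_on_Im[OF \<phi>_cont]] obtain b where "(\<lambda>n. \<Sum>i\<le>n. W n i * Im (?\<phi> (real i / real n))) \<longlonglongrightarrow> b"
        unfolding convergent_def by (rule exE)
      ultimately have "(\<lambda>n. F n z) \<longlonglongrightarrow> Complex a b" unfolding eq by (rule tendsto_Complex)
      thus ?thesis by (auto simp: convergent_def)
    qed
    then obtain L where L: "(\<lambda>n. F n z) \<longlonglongrightarrow> L" by (auto simp: convergent_def)
    from LIMSEQ_subseq_LIMSEQ[OF L r] H_lim[OF z] have "L = H z"
      by (auto simp: o_def intro: LIMSEQ_unique)
    with L show ?thesis by simp
  qed
  have "(\<lambda>k. of_real (c k * M (\<mu> + real k)) * z ^ k) sums H z" if z: "z \<in> ball 0 1" for z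
  proof -
    have nz: "norm z < 1" using z by simp
    note series = moment_approx_series[OF W \<mu> slit_sum_abs_summable[OF G nz]]
    have in_ball: "z * of_real (real i / real n) \<in> ball 0 1" if "i \<le> n" for i n
    proof -
      have "norm z * (real i / real n) \<le> norm z * 1" using unit[OF that] by (intro mult_left_mono) auto
      thus ?thesis using nz unit[OF that] by (simp add: norm_mult norm_divide del: times_divide_eq_right)
    qed
    have "F n z = (\<Sum>i\<le>n. of_real (W n i * (real i / real n) powr (\<delta> + \<mu>)) *
            (\<Sum>k. of_real (c k) * (z * of_real (real i / real n)) ^ k))" for n
      unfolding F_def using G_sums[OF in_ball] by (intro sum.cong refl) (simp add: sums_iff)
    hence "(\<lambda>n. F n z) \<longlonglongrightarrow> (\<Sum>k. of_real (c k * M (\<mu> + real k)) * z ^ k)"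
      using series(2) by simp
    hence "(\<Sum>k. of_real (c k * M (\<mu> + real k)) * z ^ k) = H z"
      using F_lim[of z] z ball_subset_slit_plane LIMSEQ_unique by blast
    thus ?thesis using summable_norm_cancel[OF series(1)] by (simp add: sums_iff)
  qed
  with H_hol have "slit_sum (\<lambda>k. c k * M (\<mu> + real k)) H" by (simp add: slit_sum_def)
  thus ?thesis by (rule that) (use F_lim in \<open>simp add: F_def\<close>)
qed

section \<open>Analytic continuation of hypergeometric series\<close>

lemma slit_sum_geometric: "slit_sum (\<lambda>_. 1) (\<lambda>z. 1 / (1 - z))"
  unfolding slit_sum_def
proof (intro conjI ballI)
  have "1 - z \<noteq> 0" if "z \<in> slit_plane" for z
    using that by (auto intro: image_eqI[of _ _ 1])
  thus "(\<lambda>z. 1 / (1 - z)) holomorphic_on slit_plane" by (intro holomorphic_intros) auto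
qed (auto intro: geometric_sums)

lemma slit_sum_cmult:
  assumes "slit_sum c G"
  shows "slit_sum (\<lambda>k. a * c k) (\<lambda>z. of_real a * G z)"
  using assms sums_mult[of "\<lambda>k. of_real (c k) * _ ^ k" _ "of_real a :: complex"]
  by (auto simp: slit_sum_def mult.assoc intro!: holomorphic_intros)

lemma slit_sum_linear_factor:
  assumes "slit_sum c G"
  shows "slit_sum (\<lambda>k. (b + real k) * c k) (\<lambda>z. of_real b * G z + z * deriv G z)"
  unfolding slit_sum_def
proof (intro conjI ballI)
  have hol: "G holomorphic_on slit_plane" using assms by (simp add: slit_sum_def)
  thus "(\<lambda>z. of_real b * G z + z * deriv G z) holomorphic_on slit_plane"
    by (intro holomorphic_intros holomorphic_deriv open_slit_plane)
  fix z :: complex assume z: "z \<in> ball 0 1"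
  have sums: "(\<lambda>k. of_real (c k) * w ^ k) sums G w" if "norm w < 1" for w
    using assms that by (simp add: slit_sum_def)
  have "(G has_field_derivative deriv G z) (at z)"
    using z ball_subset_slit_plane by (intro holomorphic_derivI[OF hol open_slit_plane]) blast
  with sums have "(\<lambda>k. diffs (\<lambda>k. complex_of_real (c k)) k * z ^ k) sums deriv G z"
    by (rule termdiffs_sums_strong) (use z in auto)
  hence "(\<lambda>k. z * (diffs (\<lambda>k. complex_of_real (c k)) k * z ^ k)) sums (z * deriv G z)"
    by (rule sums_mult)
  also have "(\<lambda>k. z * (diffs (\<lambda>k. complex_of_real (c k)) k * z ^ k))
      = (\<lambda>k. of_nat (Suc k) * of_real (c (Suc k)) * z ^ Suc k)"
    by (simp add: diffs_def fun_eq_iff mult_ac)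
  finally have "(\<lambda>k. of_nat k * of_real (c k) * z ^ k) sums (z * deriv G z)"
    by (subst (asm) sums_Suc_iff[of "\<lambda>k. of_nat k * of_real (c k) * z ^ k"]) simp
  from sums_add[OF sums_mult[OF sums, of z "of_real b"] this]
  show "(\<lambda>k. of_real ((b + real k) * c k) * z ^ k) sums (of_real b * G z + z * deriv G z)"
    using z by (simp add: ring_distribs mult.assoc)
qed

lemma Gamma_ratio_pochhammer:
  assumes "\<And>a. a \<in> set as \<union> set bs \<Longrightarrow> a + s > 0"
  shows "Gamma_ratio as bs (s + real k)
       = Gamma_ratio as bs s * ((\<Prod>a\<leftarrow>shift s as. pochhammer a k) / (\<Prod>b\<leftarrow>shift s bs. pochhammer b k))"
proof -
  have "Gamma_prod (shift (s + real k) cs) = Gamma_prod (shift s cs) * (\<Prod>c\<leftarrow>shift s cs. pochhammer c k)"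
    if "\<And>c. c \<in> set cs \<Longrightarrow> c + s > 0" for cs
    using that
  proof (induction cs)
    case (Cons c cs)
    have "c + s > 0" using Cons.prems by simp
    hence "Gamma (c + s) \<noteq> 0" "c + s \<notin> \<int>\<^sub>\<le>\<^sub>0" using pos_not_nonpos_Int Gamma_real_pos by (auto simp: less_imp_neq[THEN not_sym])
    hence "Gamma (c + (s + real k)) = Gamma (c + s) * pochhammer (c + s) k"
      by (simp add: pochhammer_Gamma add_ac)
    moreover have "Gamma_prod (shift (s + real k) cs) = Gamma_prod (shift s cs) * (\<Prod>c\<leftarrow>shift s cs. pochhammer c k)"
      using Cons by simp
    ultimately show ?case by (simp add: Gamma_prod_def shift_def mult_ac)
  qed (simp add: Gamma_prod_def shift_def)
  thus ?thesis using assms by (simp add: Gamma_ratio_def)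
qed

lemma slit_sum_pochhammer_ratio_le:
  assumes "slit_sum c G" "0 < a" "a \<le> b"
  obtains H where "slit_sum (\<lambda>k. c k * (pochhammer a k / pochhammer b k)) H"
proof -
  have "v_fun [a] [b] t \<ge> 0" if "0 \<le> t" "t \<le> 1" for t
    using that assms by (simp add: v_fun_def powr_mono')
  then obtain \<delta> W where "moment_approx \<delta> W (Gamma_ratio [a] [b])"
    using Gamma_ratio_discrete_approx[of "[a]" "[b]"] assms by auto
  from moment_approx_slit_plane[OF this order_refl assms(1)] obtain H
    where H: "slit_sum (\<lambda>k. c k * Gamma_ratio [a] [b] (0 + real k)) H" by metis
  have pos: "Gamma_ratio [a] [b] 0 > 0" using assms by (intro Gamma_ratio_pos) auto
  have "(\<lambda>k. 1 / Gamma_ratio [a] [b] 0 * (c k * Gamma_ratio [a] [b] (0 + real k)))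
      = (\<lambda>k. c k * (pochhammer a k / pochhammer b k))"
    using pos assms by (subst Gamma_ratio_pochhammer) (auto simp: shift_def)
  with slit_sum_cmult[OF H, of "1 / Gamma_ratio [a] [b] 0"] that show ?thesis by metis
qed

text \<open>
  If \<open>b\<close> is below \<open>a\<close>, raise it by an integer first and return with
  \<open>1 / (b)\<^sub>k = (b + k) / (b * (b + 1)\<^sub>k)\<close>; the factor \<open>b + k\<close> is a first-order differential operator.
\<close>

lemma slit_sum_pochhammer_ratio:
  assumes "slit_sum c G" "0 < a" "b \<notin> \<int>\<^sub>\<le>\<^sub>0"
  obtains H where "slit_sum (\<lambda>k. c k * (pochhammer a k / pochhammer b k)) H"
proof -
  have "\<exists>H. slit_sum (\<lambda>k. c k * (pochhammer a k / pochhammer b k)) H"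
    if "b \<notin> \<int>\<^sub>\<le>\<^sub>0" "a \<le> b + real N" for b N
    using that
  proof (induction N arbitrary: b)
    case 0
    thus ?case using slit_sum_pochhammer_ratio_le[OF assms(1,2), of b] by auto
  next
    case (Suc N)
    have "b + 1 \<notin> \<int>\<^sub>\<le>\<^sub>0" using Suc.prems(1) plus_one_in_nonpos_Ints_imp by blast
    with Suc.IH[of "b + 1"] Suc.prems obtain H
      where H: "slit_sum (\<lambda>k. c k * (pochhammer a k / pochhammer (b + 1) k)) H" by auto
    have b: "b \<noteq> 0" using Suc.prems by auto
    have "(\<lambda>k. 1 / b * ((b + real k) * (c k * (pochhammer a k / pochhammer (b + 1) k))))
        = (\<lambda>k. c k * (pochhammer a k / pochhammer b k))"
    proof
      fix k
      have nz: "pochhammer b k \<noteq> 0" "pochhammer (b + 1) k \<noteq> 0"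
        using \<open>b + 1 \<notin> \<int>\<^sub>\<le>\<^sub>0\<close> Suc.prems(1) by (auto simp: pochhammer_eq_0_iff)
      have rec: "b * pochhammer (b + 1) k = pochhammer b k * (b + real k)"
        by (metis pochhammer_Suc pochhammer_rec)
      hence "b + real k \<noteq> 0" using nz b by auto
      hence "(b + real k) / (b * pochhammer (b + 1) k) = 1 / pochhammer b k"
        unfolding rec using nz by simp
      hence "c k * pochhammer a k * ((b + real k) / (b * pochhammer (b + 1) k)) = c k * pochhammer a k * (1 / pochhammer b k)"
        by (rule arg_cong)
      thus "1 / b * ((b + real k) * (c k * (pochhammer a k / pochhammer (b + 1) k)))
        = c k * (pochhammer a k / pochhammer b k)"
        by (simp add: mult_ac)
    qed
    with slit_sum_cmult[OF slit_sum_linear_factor[OF H, of b], of "1 / b"] show ?case by auto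
  qed
  moreover obtain N where "a \<le> b + real N"
    using real_arch_simple[of "a - b"] by (auto simp: algebra_simps)
  ultimately show ?thesis using assms(3) that by blast
qed

lemma slit_sum_pochhammer_products_pos:
  assumes "length as = length bs" "\<And>a. a \<in> set as \<Longrightarrow> a > 0" "\<And>b. b \<in> set bs \<Longrightarrow> b \<notin> \<int>\<^sub>\<le>\<^sub>0"
  obtains H where "slit_sum (\<lambda>k. (\<Prod>a\<leftarrow>as. pochhammer a k) / (\<Prod>b\<leftarrow>bs. pochhammer b k)) H"
proof -
  have "\<exists>H. slit_sum (\<lambda>k. (\<Prod>a\<leftarrow>as. pochhammer a k) / (\<Prod>b\<leftarrow>bs. pochhammer b k)) H"
    using assms
  proof (induction as bs rule: list_induct2)
    case Nil
    thus ?case using slit_sum_geometric by auto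
  next
    case (Cons a as b bs)
    then obtain H where "slit_sum (\<lambda>k. (\<Prod>a\<leftarrow>as. pochhammer a k) / (\<Prod>b\<leftarrow>bs. pochhammer b k)) H"
      by auto
    from slit_sum_pochhammer_ratio[OF this, of a b] Cons.prems obtain H' where
      "slit_sum (\<lambda>k. (\<Prod>a\<leftarrow>as. pochhammer a k) / (\<Prod>b\<leftarrow>bs. pochhammer b k) * (pochhammer a k / pochhammer b k)) H'"
      by auto
    thus ?case by (intro exI[of _ H']) (simp add: mult_ac)
  qed
  thus ?thesis using that by blast
qed

lemma slit_sum_tail:
  assumes "slit_sum (\<lambda>k. c (k + m)) G"
  shows "slit_sum c (\<lambda>z. (\<Sum>k<m. of_real (c k) * z ^ k) + z ^ m * G z)"
  unfolding slit_sum_def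
proof (intro conjI ballI)
  show "(\<lambda>z. (\<Sum>k<m. of_real (c k) * z ^ k) + z ^ m * G z) holomorphic_on slit_plane"
    using assms by (auto simp: slit_sum_def intro!: holomorphic_intros)
  fix z :: complex assume "z \<in> ball 0 1"
  hence "(\<lambda>k. of_real (c (k + m)) * z ^ k) sums G z" using assms by (auto simp: slit_sum_def)
  from sums_mult[OF this, of "z ^ m"]
  have "(\<lambda>k. of_real (c (k + m)) * z ^ (k + m)) sums (z ^ m * G z)"
    by (simp add: power_add mult_ac)
  thus "(\<lambda>k. of_real (c k) * z ^ k) sums ((\<Sum>k<m. of_real (c k) * z ^ k) + z ^ m * G z)"
    by (subst (asm) sums_iff_shift) (simp add: add_ac)
qed

text \<open>
  Numerator parameters that are not positive are treated by splitting off the first \<open>m\<close> terms: the remaining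
  series has all parameters increased by \<open>m\<close>.
\<close>

lemma slit_sum_pochhammer_products:
  assumes "length as = length bs" "\<And>b. b \<in> set bs \<Longrightarrow> b \<notin> \<int>\<^sub>\<le>\<^sub>0"
  obtains H where "slit_sum (\<lambda>k. (\<Prod>a\<leftarrow>as. pochhammer a k) / (\<Prod>b\<leftarrow>bs. pochhammer b k)) H"
proof -
  obtain m :: nat where m: "\<And>a. a \<in> set as \<Longrightarrow> a + real m > 0"
  proof -
    obtain m :: nat where "real m > Max (insert 0 (uminus ` set as))" using reals_Archimedean2 by blast
    thus ?thesis by (intro that[of m]) (auto simp: Max_less_iff)
  qed
  have b: "b + real m \<notin> \<int>\<^sub>\<le>\<^sub>0" if "b \<in> set bs" for b
  proof (induction m)
    case (Suc m)
    have "b + real (Suc m) = (b + real m) + 1" by simp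
    with Suc show ?case using plus_one_in_nonpos_Ints_imp by metis
  qed (use assms(2)[OF that] in simp)
  have split: "(\<Prod>c\<leftarrow>cs. pochhammer c (k + m)) = (\<Prod>c\<leftarrow>cs. pochhammer c m) * (\<Prod>c\<leftarrow>shift (real m) cs. pochhammer c k)"
    for cs k
    by (induction cs) (simp_all add: shift_def pochhammer_product'[of _ m k, unfolded add.commute[of m k]] mult_ac)
  obtain H where "slit_sum (\<lambda>k. (\<Prod>a\<leftarrow>shift (real m) as. pochhammer a k) / (\<Prod>b\<leftarrow>shift (real m) bs. pochhammer b k)) H"
    using slit_sum_pochhammer_products_pos[of "shift (real m) as" "shift (real m) bs"] m b assms(1)
    by (auto simp: shift_def)
  from slit_sum_cmult[OF this, of "(\<Prod>a\<leftarrow>as. pochhammer a m) / (\<Prod>b\<leftarrow>bs. pochhammer b m)"]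
  show ?thesis by (intro that[OF slit_sum_tail[where m = m]]) (simp add: split)
qed

definition hyp_coeff :: "real list \<Rightarrow> real list \<Rightarrow> nat \<Rightarrow> real" where
  "hyp_coeff as bs k = (\<Prod>a\<leftarrow>as. pochhammer a k) / ((\<Prod>b\<leftarrow>bs. pochhammer b k) * fact k)"

lemma fps_hypergeo_of_real:
  "fps_hypergeo (map complex_of_real as) (map complex_of_real bs) 1 $ k = of_real (hyp_coeff as bs k)"
proof -
  have "foldl (\<lambda>r a. r * pochhammer a k) v (map complex_of_real cs)
      = v * of_real (\<Prod>c\<leftarrow>cs. pochhammer c k)" for cs v
    by (induction cs arbitrary: v) (simp_all add: pochhammer_of_real)
  thus ?thesis by (simp add: hyp_coeff_def)
qed

lemma pochhammer_products_ratio_bounded: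
  assumes "length as \<le> length bs"
  shows "\<exists>L. (\<lambda>k. (\<Prod>a\<leftarrow>as. a + real k) / (\<Prod>b\<leftarrow>bs. b + real k)) \<longlonglongrightarrow> L"
  using assms
proof (induction bs arbitrary: as)
  case (Cons b bs)
  show ?case
  proof (cases as)
    case Nil
    from Cons.IH[of "[]"] obtain L where L: "(\<lambda>k. 1 / (\<Prod>b\<leftarrow>bs. b + real k)) \<longlonglongrightarrow> L" by auto
    have "(\<lambda>k. 1 / (b + real k)) \<longlonglongrightarrow> 0" by real_asymp
    from tendsto_mult[OF this L] show ?thesis by (auto simp: Nil)
  next
    case [simp]: (Cons a as')
    from Cons.IH[of as'] Cons.prems obtain L
      where L: "(\<lambda>k. (\<Prod>a\<leftarrow>as'. a + real k) / (\<Prod>b\<leftarrow>bs. b + real k)) \<longlonglongrightarrow> L" by auto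
    have "(\<lambda>k. (a + real k) / (b + real k)) \<longlonglongrightarrow> 1" by real_asymp
    from tendsto_mult[OF this L] show ?thesis by auto
  qed
qed auto

lemma hyp_coeff_abs_summable:
  fixes z :: complex
  assumes "length as \<le> length bs"
  shows "summable (\<lambda>k. norm (of_real (hyp_coeff as bs k) * z ^ k))"
proof -
  define R where "R = (\<lambda>k. (\<Prod>a\<leftarrow>as. a + real k) / (\<Prod>b\<leftarrow>bs. b + real k) / real (Suc k))"
  have prod_Suc: "(\<Prod>c\<leftarrow>cs. pochhammer c (Suc k)) = (\<Prod>c\<leftarrow>cs. pochhammer c k) * (\<Prod>c\<leftarrow>cs. c + real k)"
    for cs :: "real list" and k
    by (induction cs) (simp_all add: pochhammer_Suc)
  have step: "hyp_coeff as bs (Suc k) = hyp_coeff as bs k * R k" for k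
    by (simp add: hyp_coeff_def R_def prod_Suc)
  obtain L where "(\<lambda>k. (\<Prod>a\<leftarrow>as. a + real k) / (\<Prod>b\<leftarrow>bs. b + real k)) \<longlonglongrightarrow> L"
    using pochhammer_products_ratio_bounded[OF assms] by auto
  from tendsto_mult[OF this LIMSEQ_Suc[OF lim_1_over_n]] have "R \<longlonglongrightarrow> 0"
    by (simp add: R_def[abs_def] del: of_nat_Suc)
  hence "(\<lambda>k. \<bar>R k\<bar> * norm z) \<longlonglongrightarrow> \<bar>0\<bar> * norm z" by (intro tendsto_intros)
  hence "\<forall>\<^sub>F k in sequentially. \<bar>R k\<bar> * norm z < 1 / 2" by (intro order_tendstoD(2)) auto
  then obtain N where N: "\<And>k. k \<ge> N \<Longrightarrow> \<bar>R k\<bar> * norm z < 1 / 2" by (auto simp: eventually_sequentially)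
  show ?thesis
  proof (rule summable_ratio_test[of "1 / 2" N])
    fix k assume "k \<ge> N"
    have "norm (of_real (hyp_coeff as bs (Suc k)) * z ^ Suc k)
        = (\<bar>R k\<bar> * norm z) * norm (of_real (hyp_coeff as bs k) * z ^ k)"
      by (simp add: step norm_mult norm_power abs_mult mult_ac)
    also have "\<dots> \<le> 1 / 2 * norm (of_real (hyp_coeff as bs k) * z ^ k)"
      using N[OF \<open>k \<ge> N\<close>] by (intro mult_right_mono) auto
    finally show "norm (norm (of_real (hyp_coeff as bs (Suc k)) * z ^ Suc k))
        \<le> 1 / 2 * norm (norm (of_real (hyp_coeff as bs k) * z ^ k))" by simp
  qed simp
qed

lemma hypergeo_entire:
  assumes "length as \<le> length bs"
  shows "hypergeo (map complex_of_real as) (map complex_of_real bs) z = (\<Sum>k. of_real (hyp_coeff as bs k) * z ^ k)"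
  unfolding hypergeo_def eval_fps_def fps_hypergeo_of_real using assms by simp

text \<open>
  The factorial is the Pochhammer symbol of \<open>1\<close>, which makes the two parameter lists equally long.
\<close>

lemma slit_sum_hyp_coeff:
  assumes "length as = length bs + 1" "\<And>b. b \<in> set bs \<Longrightarrow> b \<notin> \<int>\<^sub>\<le>\<^sub>0"
  obtains G where "slit_sum (hyp_coeff as bs) G"
proof -
  have "(\<lambda>k. (\<Prod>a\<leftarrow>as. pochhammer a k) / (\<Prod>b\<leftarrow>(1 # bs). pochhammer b k)) = hyp_coeff as bs"
    by (simp add: hyp_coeff_def fun_eq_iff pochhammer_fact mult_ac)
  moreover have "b \<notin> \<int>\<^sub>\<le>\<^sub>0" if "b \<in> set (1 # bs)" for b
    using that assms(2) pos_not_nonpos_Int[of 1] by auto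
  ultimately show ?thesis
    using slit_sum_pochhammer_products[of as "1 # bs"] assms(1) that by (metis Suc_eq_plus1 length_Cons)
qed

lemma hypergeo_slit_plane:
  assumes "length as = length bs + 1" "slit_sum (hyp_coeff as bs) G" "z \<in> slit_plane"
  shows "hypergeo (map complex_of_real as) (map complex_of_real bs) z = G z"
proof (rule hypergeo_eqI)
  show "continues_series (map complex_of_real as) (map complex_of_real bs) G"
    using assms(2) unfolding continues_series_def slit_sum_def eval_fps_def fps_hypergeo_of_real
    by (auto simp: sums_iff)
qed (use assms in auto)

text \<open>
  The Gamma factors in front of the series merge with the Pochhammer symbols, since
  \<open>\<Gamma>(a + \<mu>) * (a + \<mu>)\<^sub>k = \<Gamma>(a + \<mu> + k)\<close>: the dependence on \<open>\<mu>\<close> becomes a shift of the argument.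
\<close>

lemma hyp_coeff_Gamma_ratio:
  assumes "\<And>a. a \<in> set as \<union> set bs \<Longrightarrow> a + \<mu> > 0"
  shows "Gamma_ratio as bs \<mu> * hyp_coeff (a1 @ shift \<mu> as) (b1 @ shift \<mu> bs) k
       = hyp_coeff a1 b1 k * Gamma_ratio as bs (\<mu> + real k)"
  using assms by (subst Gamma_ratio_pochhammer) (simp_all add: hyp_coeff_def mult_ac)

lemma f_hyp_entire:
  assumes "length a1 + length a2 \<le> length b1 + length b2"
    and pos: "\<And>a. a \<in> set a2 \<union> set b2 \<Longrightarrow> a + \<mu> > 0"
  shows "summable (\<lambda>k. \<bar>hyp_coeff a1 b1 k * Gamma_ratio a2 b2 (\<mu> + real k) * x ^ k\<bar>)"
    and "f_hyp a1 a2 b1 b2 \<mu> x = (\<Sum>k. hyp_coeff a1 b1 k * Gamma_ratio a2 b2 (\<mu> + real k) * x ^ k)"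
proof -
  let ?c = "hyp_coeff (a1 @ shift \<mu> a2) (b1 @ shift \<mu> b2)"
  have len: "length (a1 @ shift \<mu> a2) \<le> length (b1 @ shift \<mu> b2)" using assms by (simp add: shift_def)
  have sm: "summable (\<lambda>k. \<bar>?c k * x ^ k\<bar>)"
    using hyp_coeff_abs_summable[OF len, of "of_real x"]
    by (simp add: norm_mult norm_power abs_mult power_abs)
  have eq: "hyp_coeff a1 b1 k * Gamma_ratio a2 b2 (\<mu> + real k) * x ^ k = Gamma_ratio a2 b2 \<mu> * (?c k * x ^ k)" for k
    by (simp only: hyp_coeff_Gamma_ratio[OF pos, symmetric] mult.assoc)
  show "summable (\<lambda>k. \<bar>hyp_coeff a1 b1 k * Gamma_ratio a2 b2 (\<mu> + real k) * x ^ k\<bar>)"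
    unfolding eq abs_mult[of "Gamma_ratio a2 b2 \<mu>"] by (intro summable_mult sm)
  have "(\<Sum>k. of_real (?c k) * complex_of_real x ^ k) = of_real (\<Sum>k. ?c k * x ^ k)"
    using suminf_of_real[OF summable_rabs_cancel[OF sm], where ?'a = complex] by simp
  hence "hypergeo_real (a1 @ shift \<mu> a2) (b1 @ shift \<mu> b2) x = (\<Sum>k. ?c k * x ^ k)"
    unfolding hypergeo_real_def hypergeo_entire[OF len] by simp
  thus "f_hyp a1 a2 b1 b2 \<mu> x = (\<Sum>k. hyp_coeff a1 b1 k * Gamma_ratio a2 b2 (\<mu> + real k) * x ^ k)"
    unfolding eq using suminf_mult[OF summable_rabs_cancel[OF sm], of "Gamma_ratio a2 b2 \<mu>"]
    by (simp add: f_hyp_def Gamma_ratio_def)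
qed

lemma f_hyp_slit_plane:
  assumes "length a1 + length a2 = length b1 + length b2 + 1"
    and pos: "\<And>a. a \<in> set a2 \<union> set b2 \<Longrightarrow> a + \<mu> > 0" and "x < 1"
    and H: "slit_sum (\<lambda>k. hyp_coeff a1 b1 k * Gamma_ratio a2 b2 (\<mu> + real k)) H"
  shows "f_hyp a1 a2 b1 b2 \<mu> x = Re (H (of_real x))"
proof -
  let ?c = "hyp_coeff (a1 @ shift \<mu> a2) (b1 @ shift \<mu> b2)" and ?R = "Gamma_ratio a2 b2 \<mu>"
  have R: "?R > 0" using pos by (rule Gamma_ratio_pos)
  have "(\<lambda>k. 1 / ?R * (hyp_coeff a1 b1 k * Gamma_ratio a2 b2 (\<mu> + real k))) = ?c"
  proof
    fix k
    have "hyp_coeff a1 b1 k * Gamma_ratio a2 b2 (\<mu> + real k) = ?R * ?c k"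
      by (rule hyp_coeff_Gamma_ratio[OF pos, symmetric])
    thus "1 / ?R * (hyp_coeff a1 b1 k * Gamma_ratio a2 b2 (\<mu> + real k)) = ?c k"
      using R by simp
  qed
  with slit_sum_cmult[OF H, of "1 / ?R"] have "slit_sum ?c (\<lambda>z. of_real (1 / ?R) * H z)"
    by simp
  moreover have "length (a1 @ shift \<mu> a2) = length (b1 @ shift \<mu> b2) + 1" using assms by (simp add: shift_def)
  moreover have "complex_of_real x \<in> slit_plane" using assms(3) by auto
  ultimately have "hypergeo_real (a1 @ shift \<mu> a2) (b1 @ shift \<mu> b2) x = Re (of_real (1 / ?R) * H (of_real x))"
    unfolding hypergeo_real_def by (subst hypergeo_slit_plane) auto
  thus ?thesis using R by (simp add: f_hyp_def Gamma_ratio_def[symmetric] del: of_real_divide)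
qed

lemma f_hyp_slit_sum:
  assumes "length a1 + length a2 = length b1 + length b2 + 1"
    and pos: "\<And>a. a \<in> set a2 \<union> set b2 \<Longrightarrow> a + \<mu> > 0"
    and b1: "\<And>b. b \<in> set b1 \<Longrightarrow> b \<notin> \<int>\<^sub>\<le>\<^sub>0"
  obtains H where "slit_sum (\<lambda>k. hyp_coeff a1 b1 k * Gamma_ratio a2 b2 (\<mu> + real k)) H"
proof -
  have "b \<notin> \<int>\<^sub>\<le>\<^sub>0" if "b \<in> set (b1 @ shift \<mu> b2)" for b
    using that b1 pos pos_not_nonpos_Int by (auto simp: shift_def)
  moreover have "length (a1 @ shift \<mu> a2) = length (b1 @ shift \<mu> b2) + 1" using assms by (simp add: shift_def)
  ultimately obtain G where "slit_sum (hyp_coeff (a1 @ shift \<mu> a2) (b1 @ shift \<mu> b2)) G"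
    using slit_sum_hyp_coeff by metis
  from slit_sum_cmult[OF this, of "Gamma_ratio a2 b2 \<mu>"] show ?thesis
    by (intro that) (simp only: hyp_coeff_Gamma_ratio[OF pos])
qed

section \<open>Log-convexity\<close>

lemma log_convex_onD:
  assumes "log_convex_on S f" "u \<in> S" "v \<in> S" "0 < s" "s < 1"
  shows "f ((1 - s) * u + s * v) \<le> f u powr (1 - s) * f v powr s"
  using assms by (simp add: log_convex_on_def)

lemma log_convex_on_nonneg: "log_convex_on S f \<Longrightarrow> u \<in> S \<Longrightarrow> f u \<ge> 0"
  by (simp add: log_convex_on_def)

lemma log_convex_on_const:
  assumes "convex S" "c \<ge> 0"
  shows "log_convex_on S (\<lambda>_. c)"
  using assms by (auto simp: log_convex_on_def simp flip: powr_add)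

lemma log_convex_on_powr:
  assumes "convex S" "t \<ge> 0"
  shows "log_convex_on S (\<lambda>\<mu>. t powr (d + \<mu>))"
proof -
  have "t powr (d + ((1 - s) * u + s * v)) = (t powr (d + u)) powr (1 - s) * (t powr (d + v)) powr s" for s u v
  proof -
    have eq: "d + ((1 - s) * u + s * v) = (d + u) * (1 - s) + (d + v) * s" by (simp add: algebra_simps)
    show ?thesis by (simp only: eq powr_powr powr_add[symmetric])
  qed
  thus ?thesis using assms by (simp add: log_convex_on_def)
qed

lemma log_convex_on_mult:
  assumes "log_convex_on S f" "log_convex_on S g"
  shows "log_convex_on S (\<lambda>\<mu>. f \<mu> * g \<mu>)"
  unfolding log_convex_on_def
proof (intro conjI ballI allI impI)
  fix u v s :: real assume *: "u \<in> S" "v \<in> S" "0 < s \<and> s < 1"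
  let ?w = "(1 - s) * u + s * v"
  have "?w \<in> S"
    using assms(1) * convexD[of S u v "1 - s" s] by (simp add: log_convex_on_def)
  hence "f ?w * g ?w \<le> (f u powr (1 - s) * f v powr s) * (g u powr (1 - s) * g v powr s)"
    using * assms by (intro mult_mono log_convex_onD[of S]) (auto intro: log_convex_on_nonneg)
  thus "f ?w * g ?w \<le> (f u * g u) powr (1 - s) * (f v * g v) powr s"
    by (simp add: powr_mult mult_ac)
qed (use assms in \<open>auto simp: log_convex_on_def\<close>)

lemma log_convex_on_limit:
  assumes "\<And>n :: nat. log_convex_on S (F n)" "\<And>\<mu>. \<mu> \<in> S \<Longrightarrow> (\<lambda>n. F n \<mu>) \<longlonglongrightarrow> f \<mu>"
  shows "log_convex_on S f"
  unfolding log_convex_on_def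
proof (intro conjI ballI allI impI)
  show S: "convex S" using assms(1) by (simp add: log_convex_on_def)
  show "f u \<ge> 0" if "u \<in> S" for u
    using assms(1) that by (intro LIMSEQ_le_const[OF assms(2)[OF that]]) (auto simp: log_convex_on_def)
  fix u v s :: real assume *: "u \<in> S" "v \<in> S" "0 < s \<and> s < 1"
  let ?w = "(1 - s) * u + s * v"
  have "?w \<in> S" using S * convexD[of S u v "1 - s" s] by simp
  have "(\<lambda>n. F n u powr (1 - s) * F n v powr s) \<longlonglongrightarrow> f u powr (1 - s) * f v powr s"
    using * assms(1) by (intro tendsto_mult tendsto_powr' assms(2) tendsto_const)
                        (auto simp: log_convex_on_def)
  thus "f ?w \<le> f u powr (1 - s) * f v powr s"
    by (rule LIMSEQ_le[OF assms(2)[OF \<open>?w \<in> S\<close>]]) (use * assms(1) in \<open>auto intro: log_convex_onD\<close>)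
qed

text \<open>
  Hoelder's inequality, derived from Young's inequality.
\<close>

lemma log_convex_on_integral:
  assumes S: "convex S" and lc: "\<And>t. t \<in> space M \<Longrightarrow> log_convex_on S (\<lambda>\<mu>. \<phi> \<mu> t)"
    and int: "\<And>\<mu>. \<mu> \<in> S \<Longrightarrow> integrable M (\<phi> \<mu>)"
  shows "log_convex_on S (\<lambda>\<mu>. \<integral>t. \<phi> \<mu> t \<partial>M)"
  unfolding log_convex_on_def
proof (intro conjI ballI allI impI)
  have nonneg: "\<phi> \<mu> t \<ge> 0" if "\<mu> \<in> S" "t \<in> space M" for \<mu> t
    using lc[OF that(2)] that(1) by (simp add: log_convex_on_def)
  show "(\<integral>t. \<phi> u t \<partial>M) \<ge> 0" if "u \<in> S" for u
    using nonneg that by (intro integral_nonneg_AE AE_I2) auto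
  fix u v s :: real assume *: "u \<in> S" "v \<in> S" and s: "0 < s \<and> s < 1"
  define w where "w = (1 - s) * u + s * v"
  have w: "w \<in> S" unfolding w_def using S * s convexD[of S u v "1 - s" s] by simp
  define A B where "A = (\<integral>t. \<phi> u t \<partial>M)" and "B = (\<integral>t. \<phi> v t \<partial>M)"
  have AB: "A \<ge> 0" "B \<ge> 0" unfolding A_def B_def
    using nonneg * by (auto intro!: integral_nonneg_AE AE_I2)
  \<comment> \<open>The integrals \<open>A\<close> and \<open>B\<close> may vanish; normalizing by \<open>A + e\<close> and \<open>B + e\<close> avoids division by zero.\<close>
  have bound: "(\<integral>t. \<phi> w t \<partial>M) \<le> (A + e) powr (1 - s) * (B + e) powr s" if e: "e > 0" for e
  proof -
    define A' B' where "A' = A + e" and "B' = B + e"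
    have pos: "A' > 0" "B' > 0" using AB e by (auto simp: A'_def B'_def)
    define K where "K = A' powr (1 - s) * B' powr s"
    have K: "K > 0" using pos by (simp add: K_def)
    have pt: "\<phi> w t \<le> K * ((1 - s) * (\<phi> u t / A') + s * (\<phi> v t / B'))" if t: "t \<in> space M" for t
    proof -
      let ?a = "\<phi> u t / A'" and ?b = "\<phi> v t / B'"
      have ab: "?a \<ge> 0" "?b \<ge> 0" using pos nonneg * t by auto
      have young: "?a powr (1 - s) * ?b powr s \<le> (1 - s) * ?a + s * ?b"
      proof (cases "?a = 0 \<or> ?b = 0")
        case True
        hence eq0: "?a powr (1 - s) * ?b powr s = 0" by auto
        show ?thesis unfolding eq0 using ab s by (intro add_nonneg_nonneg mult_nonneg_nonneg) auto
      next
        case False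
        hence "?a > 0" "?b > 0" using ab by linarith+
        thus ?thesis using s by (intro Youngs_inequality_0) auto
      qed
      have "\<phi> w t \<le> \<phi> u t powr (1 - s) * \<phi> v t powr s"
        unfolding w_def using lc[OF t] * s by (intro log_convex_onD) auto
      also have "\<dots> = K * (?a powr (1 - s) * ?b powr s)"
        using pos by (simp add: K_def powr_divide)
      also have "\<dots> \<le> K * ((1 - s) * ?a + s * ?b)"
        using K by (intro mult_left_mono young) auto
      finally show ?thesis .
    qed
    have "(\<integral>t. \<phi> w t \<partial>M) \<le> (\<integral>t. K * ((1 - s) * (\<phi> u t / A') + s * (\<phi> v t / B')) \<partial>M)"
      using int w * pt by (intro integral_mono) auto
    also have "\<dots> = K * ((1 - s) * (A / A') + s * (B / B'))"
      using int * by (simp add: A_def B_def)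
    also have "\<dots> \<le> K * ((1 - s) * 1 + s * 1)"
      using K s pos e by (intro mult_left_mono add_mono) (auto simp: A'_def B'_def)
    finally show ?thesis by (simp add: K_def A'_def B'_def)
  qed
  have "((\<lambda>e. (A + e) powr (1 - s) * (B + e) powr s) \<longlongrightarrow> (A + 0) powr (1 - s) * (B + 0) powr s) (at_right 0)"
    using AB s by (intro tendsto_mult tendsto_powr' tendsto_intros)
                  (auto simp: eventually_at_filter intro!: always_eventually)
  hence "(\<integral>t. \<phi> w t \<partial>M) \<le> (A + 0) powr (1 - s) * (B + 0) powr s"
    by (rule tendsto_lowerbound) (auto simp: eventually_at_filter intro!: always_eventually bound)
  thus "(\<integral>t. \<phi> ((1 - s) * u + s * v) t \<partial>M) \<le> (\<integral>t. \<phi> u t \<partial>M) powr (1 - s) * (\<integral>t. \<phi> v t \<partial>M) powr s"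
    by (simp add: A_def B_def w_def)
qed fact

lemma log_convex_on_sum:
  assumes "finite I" "convex S" "\<And>i. i \<in> I \<Longrightarrow> log_convex_on S (\<phi> i)"
  shows "log_convex_on S (\<lambda>\<mu>. \<Sum>i\<in>I. \<phi> i \<mu>)"
  using log_convex_on_integral[of S "count_space I" "\<lambda>\<mu> i. \<phi> i \<mu>"] assms
  by (simp add: lebesgue_integral_count_space_finite integrable_count_space)

text \<open>
  Both \<open>\<mu> + \<alpha>\<close> and \<open>\<mu> + \<beta>\<close> are convex combinations of \<open>\<mu>\<close> and \<open>\<mu> + \<alpha> + \<beta>\<close>, with exchanged weights.
\<close>

lemma log_convex_imp_four_point:
  assumes lc: "log_convex_on {0..} f" and "\<alpha> > 0" "\<beta> > 0" "\<mu> \<ge> 0"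
  shows "f (\<mu> + \<alpha>) * f (\<mu> + \<beta>) \<le> f \<mu> * f (\<mu> + \<alpha> + \<beta>)"
proof -
  define a b where "a = f \<mu>" and "b = f (\<mu> + \<alpha> + \<beta>)"
  define s where "s = \<alpha> / (\<alpha> + \<beta>)"
  have s: "0 < s" "s < 1" "1 - s = \<beta> / (\<alpha> + \<beta>)" using assms by (auto simp: s_def field_simps)
  have ab: "a \<ge> 0" "b \<ge> 0" and f: "f (\<mu> + \<alpha>) \<ge> 0" "f (\<mu> + \<beta>) \<ge> 0"
    unfolding a_def b_def using assms by (auto intro!: log_convex_on_nonneg[OF lc])
  have "(1 - s) * \<mu> + s * (\<mu> + \<alpha> + \<beta>) = \<mu> + s * (\<alpha> + \<beta>)"
    "(1 - (1 - s)) * \<mu> + (1 - s) * (\<mu> + \<alpha> + \<beta>) = \<mu> + (1 - s) * (\<alpha> + \<beta>)" by (simp_all add: algebra_simps)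
  moreover have "s * (\<alpha> + \<beta>) = \<alpha>" "(1 - s) * (\<alpha> + \<beta>) = \<beta>"
    using assms s(3) by (simp_all add: s_def)
  ultimately have pt: "(1 - s) * \<mu> + s * (\<mu> + \<alpha> + \<beta>) = \<mu> + \<alpha>"
    "(1 - (1 - s)) * \<mu> + (1 - s) * (\<mu> + \<alpha> + \<beta>) = \<mu> + \<beta>" by simp_all
  have 1: "f (\<mu> + \<alpha>) \<le> a powr (1 - s) * b powr s"
    using log_convex_onD[OF lc, of \<mu> "\<mu> + \<alpha> + \<beta>" s] assms s unfolding pt a_def b_def by simp
  have 2: "f (\<mu> + \<beta>) \<le> a powr s * b powr (1 - s)"
    using log_convex_onD[OF lc, of \<mu> "\<mu> + \<alpha> + \<beta>" "1 - s"] assms s(1,2) unfolding pt a_def b_def by simp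
  have "f (\<mu> + \<alpha>) * f (\<mu> + \<beta>) \<le> (a powr (1 - s) * b powr s) * (a powr s * b powr (1 - s))"
    using f by (intro mult_mono 1 2) auto
  also have "\<dots> = (a powr (1 - s) * a powr s) * (b powr s * b powr (1 - s))" by (simp add: mult_ac)
  also have "\<dots> = a * b" using ab by (simp flip: powr_add)
  finally show ?thesis by (simp add: a_def b_def)
qed

text \<open>
  Put \<open>P = f (\<mu> + \<alpha> + \<beta>)\<close>.  Monotonicity bounds the left-hand side by \<open>f \<mu> * P - P\<^sup>2\<close>, which is at most
  \<open>(f \<mu>)\<^sup>2 / 4\<close>.
\<close>

lemma antimono_imp_quarter_bound:
  fixes f :: "real \<Rightarrow> real"
  assumes nonneg: "\<And>\<mu>. \<mu> \<ge> 0 \<Longrightarrow> f \<mu> \<ge> 0"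
    and anti: "\<And>\<mu> \<nu>. 0 \<le> \<mu> \<Longrightarrow> \<mu> \<le> \<nu> \<Longrightarrow> f \<nu> \<le> f \<mu>"
    and "\<alpha> > 0" "\<beta> > 0" "\<mu> \<ge> 0"
  shows "f \<mu> * f (\<mu> + \<alpha> + \<beta>) - f (\<mu> + \<alpha>) * f (\<mu> + \<beta>) \<le> 1 / 4 * (f \<mu>)\<^sup>2"
proof -
  let ?P = "f (\<mu> + \<alpha> + \<beta>)"
  have "?P * ?P \<le> f (\<mu> + \<alpha>) * f (\<mu> + \<beta>)"
    using assms by (intro mult_mono anti nonneg) auto
  moreover have "0 \<le> (f \<mu> / 2 - ?P)\<^sup>2" by simp
  ultimately show ?thesis by (simp add: power2_eq_square algebra_simps)
qed

section \<open>Gamma integrals and Landau's theorem\<close>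

definition gamma_kernel :: "real \<Rightarrow> real \<Rightarrow> real \<Rightarrow> real" where
  "gamma_kernel A \<sigma> t = indicator {0<..} t * (t powr (A - 1) * exp (- (\<sigma> * t)))"

lemma gamma_kernel_measurable [measurable]: "gamma_kernel A \<sigma> \<in> borel_measurable borel"
  unfolding gamma_kernel_def[abs_def] by measurable

lemma gamma_kernel_nonneg: "gamma_kernel A \<sigma> t \<ge> 0"
  by (simp add: gamma_kernel_def)

lemma gamma_kernel_has_integral:
  assumes "A > 0" "\<sigma> > 0"
  shows "has_bochner_integral lborel (gamma_kernel A \<sigma>) (Gamma A * \<sigma> powr (- A))"
proof -
  have "has_bochner_integral lborel (gamma_kernel A 1) (Gamma A)"
  proof (rule has_bochner_integral_nn_integral)
    have "(\<lambda>t. ennreal (indicator {0..} t * t powr (A - 1) / exp t)) = (\<lambda>t. ennreal (gamma_kernel A 1 t))"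
      by (auto simp: gamma_kernel_def fun_eq_iff indicator_def exp_minus field_simps)
    thus "(\<integral>\<^sup>+t. ennreal (gamma_kernel A 1 t) \<partial>lborel) = ennreal (Gamma A)"
      using Gamma_conv_nn_integral_real[OF assms(1)] by simp
  qed (use assms in \<open>auto simp: gamma_kernel_nonneg\<close>)
  hence "has_bochner_integral lborel (\<lambda>t. gamma_kernel A 1 (0 + \<sigma> * t)) (Gamma A /\<^sub>R \<bar>\<sigma>\<bar>)"
    using lborel_has_bochner_integral_real_affine_iff[of \<sigma> "gamma_kernel A 1" "Gamma A" 0] assms by simp
  from has_bochner_integral_mult_right[OF this, of "\<sigma> powr (1 - A)"]
  have "has_bochner_integral lborel (\<lambda>t. \<sigma> powr (1 - A) * gamma_kernel A 1 (0 + \<sigma> * t))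
          (\<sigma> powr (1 - A) * (Gamma A /\<^sub>R \<bar>\<sigma>\<bar>))" by simp
  also have "(\<lambda>t. \<sigma> powr (1 - A) * gamma_kernel A 1 (0 + \<sigma> * t)) = gamma_kernel A \<sigma>"
  proof
    fix t
    show "\<sigma> powr (1 - A) * gamma_kernel A 1 (0 + \<sigma> * t) = gamma_kernel A \<sigma> t"
    proof (cases "t > 0")
      case True
      have "\<sigma> powr (1 - A) * \<sigma> powr (A - 1) = 1" using assms by (simp flip: powr_add)
      thus ?thesis using True assms by (simp add: gamma_kernel_def powr_mult zero_less_mult_iff flip: mult.assoc)
    qed (use assms in \<open>simp add: gamma_kernel_def zero_less_mult_iff\<close>)
  qed
  also have "\<sigma> powr (1 - A) * (Gamma A /\<^sub>R \<bar>\<sigma>\<bar>) = Gamma A * \<sigma> powr (- A)"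
    using assms by (simp add: powr_diff powr_minus field_simps)
  finally show ?thesis .
qed

lemma gamma_kernel_power:
  "gamma_kernel A \<sigma> t * t ^ k = gamma_kernel (A + real k) \<sigma> t"
  by (cases "t > 0") (auto simp: gamma_kernel_def powr_realpow[symmetric] powr_add powr_diff)

text \<open>
  Termwise integration: the kernel turns the coefficients \<open>e k\<close> into \<open>e k * \<Gamma>(A + k)\<close>.
\<close>

lemma gamma_kernel_series:
  assumes A: "A > 0" and \<sigma>: "\<sigma> > 0"
    and entire: "\<And>t. summable (\<lambda>k. \<bar>e k * t ^ k\<bar>)"
    and summ: "summable (\<lambda>k. \<bar>e k * Gamma (A + real k) / \<sigma> ^ k\<bar>)"
  shows "has_bochner_integral lborel (\<lambda>t. gamma_kernel A \<sigma> t * (\<Sum>k. e k * t ^ k))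
           (\<sigma> powr (- A) * (\<Sum>k. e k * Gamma (A + real k) / \<sigma> ^ k))"
proof -
  define F where "F = (\<lambda>k t. e k * gamma_kernel (A + real k) \<sigma> t)"
  have K: "has_bochner_integral lborel (gamma_kernel (A + real k) \<sigma>) (\<sigma> powr (- A) * (Gamma (A + real k) / \<sigma> ^ k))" for k
  proof -
    have "Gamma (A + real k) * \<sigma> powr (- (A + real k)) = \<sigma> powr (- A) * (Gamma (A + real k) / \<sigma> ^ k)"
      using \<sigma> by (simp add: powr_add[symmetric] powr_diff powr_realpow)
    thus ?thesis using gamma_kernel_has_integral[of "A + real k" \<sigma>] A \<sigma> by simp
  qed
  have F_eq: "F k t = gamma_kernel A \<sigma> t * (e k * t ^ k)" for k t
    by (simp add: F_def gamma_kernel_power[symmetric])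
  have int: "integrable lborel (F k)" for k
    using K unfolding F_def by (auto simp: has_bochner_integral_iff)
  have nint: "(\<integral>t. norm (F k t) \<partial>lborel) = \<sigma> powr (- A) * \<bar>e k * Gamma (A + real k) / \<sigma> ^ k\<bar>" for k
  proof -
    have "(\<integral>t. norm (F k t) \<partial>lborel) = \<bar>e k\<bar> * (\<sigma> powr (- A) * (Gamma (A + real k) / \<sigma> ^ k))"
      using K[of k] by (simp add: F_def abs_mult abs_of_nonneg[OF gamma_kernel_nonneg] has_bochner_integral_iff)
    moreover have "Gamma (A + real k) \<ge> 0" using A by (intro Gamma_real_nonneg) auto
    ultimately show ?thesis using \<sigma> by (simp add: abs_mult)
  qed
  have ae: "AE t in lborel. summable (\<lambda>k. norm (F k t))"
  proof (rule AE_I2)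
    fix t :: real
    show "summable (\<lambda>k. norm (F k t))"
      unfolding F_eq norm_mult real_norm_def
      using summable_mult[OF entire[of t], of "\<bar>gamma_kernel A \<sigma> t\<bar>"] by (simp add: abs_mult)
  qed
  have sn: "summable (\<lambda>k. \<integral>t. norm (F k t) \<partial>lborel)"
    unfolding nint by (intro summable_mult summ)
  have sF: "(\<Sum>k. F k t) = gamma_kernel A \<sigma> t * (\<Sum>k. e k * t ^ k)" for t
    unfolding F_eq by (intro suminf_mult summable_rabs_cancel[OF entire])
  have "(\<integral>t. (\<Sum>k. F k t) \<partial>lborel) = (\<Sum>k. \<integral>t. F k t \<partial>lborel)"
    by (rule integral_suminf[OF int ae sn])
  also have "(\<lambda>k. \<integral>t. F k t \<partial>lborel) = (\<lambda>k. \<sigma> powr (- A) * (e k * Gamma (A + real k) / \<sigma> ^ k))"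
    using K by (simp add: F_def has_bochner_integral_iff fun_eq_iff)
  also have "(\<Sum>k. \<sigma> powr (- A) * (e k * Gamma (A + real k) / \<sigma> ^ k))
      = \<sigma> powr (- A) * (\<Sum>k. e k * Gamma (A + real k) / \<sigma> ^ k)"
    by (intro suminf_mult summable_rabs_cancel[OF summ])
  finally show ?thesis
    using integrable_suminf[OF int ae sn] by (simp add: has_bochner_integral_iff sF)
qed

text \<open>
  The Laplace transform of a nonnegative function converges on the whole ray along which it can be
  continued.  Expand the continuation about a point \<open>s0\<close> far to the right.  Its Taylor series converges
  in the full disk of radius \<open>s0\<close>, which reaches \<open>\<sigma>\<close>, and its coefficients are \<open>(- 1) ^ k / k!\<close> times the
  integrals \<open>M k\<close> of \<open>t ^ k * exp (- s0 t) * g t\<close>.  To the left of \<open>s0\<close> all terms are nonnegative, so summation and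
  integration may be exchanged, and the sum over \<open>k\<close> restores \<open>exp (- \<sigma> t) * g t\<close>.
\<close>

lemma landau_laplace:
  fixes g :: "real \<Rightarrow> real" and \<Phi> :: "complex \<Rightarrow> complex"
  assumes g_meas [measurable]: "g \<in> borel_measurable borel"
    and g_nonneg: "\<And>t. g t \<ge> 0" and g_supp: "\<And>t. t \<le> 0 \<Longrightarrow> g t = 0"
    and hol: "\<Phi> holomorphic_on {z. Re z > 0}"
    and J: "\<And>\<sigma>. \<sigma> > \<tau> \<Longrightarrow> has_bochner_integral lborel (\<lambda>t. exp (- (\<sigma> * t)) * g t) (J \<sigma>)"
    and \<Phi>_J: "\<And>\<sigma>. \<sigma> > \<tau> \<Longrightarrow> \<Phi> (of_real \<sigma>) = of_real (J \<sigma>)"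
    and \<tau>: "\<tau> > 0" and \<sigma>: "\<sigma> > 0"
  shows "has_bochner_integral lborel (\<lambda>t. exp (- (\<sigma> * t)) * g t) (Re (\<Phi> (of_real \<sigma>)))"
proof -
  \<comment> \<open>Any centre to the right of both \<open>\<sigma>\<close> and \<open>\<tau>\<close> would do.\<close>
  define s0 where "s0 = max \<sigma> \<tau> + 1"
  have s0: "s0 > \<sigma>" "s0 > \<tau>" "s0 > 0" using \<sigma> by (auto simp: s0_def)
  define M where "M = (\<lambda>k. \<integral>\<^sup>+t. ennreal (t ^ k * (exp (- (s0 * t)) * g t)) \<partial>lborel)"
  have expand: "(\<integral>\<^sup>+t. ennreal (exp (- (u * t)) * g t) \<partial>lborel) = (\<Sum>k. ennreal ((s0 - u) ^ k / fact k) * M k)"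
    if u: "u < s0" for u
  proof -
    have "(\<integral>\<^sup>+t. ennreal (exp (- (u * t)) * g t) \<partial>lborel)
        = (\<integral>\<^sup>+t. (\<Sum>k. ennreal ((s0 - u) ^ k / fact k) * ennreal (t ^ k * (exp (- (s0 * t)) * g t))) \<partial>lborel)"
    proof (intro nn_integral_cong)
      fix t :: real
      show "ennreal (exp (- (u * t)) * g t)
          = (\<Sum>k. ennreal ((s0 - u) ^ k / fact k) * ennreal (t ^ k * (exp (- (s0 * t)) * g t)))"
      proof (cases "t > 0")
        case True
        have "(\<lambda>k. ((s0 - u) * t) ^ k /\<^sub>R fact k) sums exp ((s0 - u) * t)" by (rule exp_converges)
        hence "(\<lambda>k. ((s0 - u) * t) ^ k /\<^sub>R fact k * (exp (- (s0 * t)) * g t))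
            sums (exp ((s0 - u) * t) * (exp (- (s0 * t)) * g t))" by (rule sums_mult2)
        also have "(\<lambda>k. ((s0 - u) * t) ^ k /\<^sub>R fact k * (exp (- (s0 * t)) * g t))
            = (\<lambda>k. (s0 - u) ^ k / fact k * (t ^ k * (exp (- (s0 * t)) * g t)))"
          by (simp only: fun_eq_iff power_mult_distrib real_scaleR_def divide_inverse mult_ac) simp
        also have "exp ((s0 - u) * t) * (exp (- (s0 * t)) * g t) = exp (- (u * t)) * g t"
          by (simp add: mult.assoc[symmetric] exp_add[symmetric] algebra_simps)
        finally have "(\<lambda>k. (s0 - u) ^ k / fact k * (t ^ k * (exp (- (s0 * t)) * g t))) sums (exp (- (u * t)) * g t)" .
        hence "ennreal (exp (- (u * t)) * g t) = (\<Sum>k. ennreal ((s0 - u) ^ k / fact k * (t ^ k * (exp (- (s0 * t)) * g t))))"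
          using u True g_nonneg by (intro suminf_ennreal_eq[symmetric] mult_nonneg_nonneg divide_nonneg_nonneg) auto
        also have "\<dots> = (\<Sum>k. ennreal ((s0 - u) ^ k / fact k) * ennreal (t ^ k * (exp (- (s0 * t)) * g t)))"
          using u True g_nonneg by (intro suminf_cong ennreal_mult) auto
        finally show ?thesis .
      qed (simp add: g_supp)
    qed
    also have "\<dots> = (\<Sum>k. \<integral>\<^sup>+t. ennreal ((s0 - u) ^ k / fact k) * ennreal (t ^ k * (exp (- (s0 * t)) * g t)) \<partial>lborel)"
      by (intro nn_integral_suminf) auto
    also have "\<dots> = (\<Sum>k. ennreal ((s0 - u) ^ k / fact k) * M k)"
      unfolding M_def by (intro suminf_cong nn_integral_cmult) auto
    finally show ?thesis .
  qed
  have J_nonneg: "J u \<ge> 0" if "u > \<tau>" for u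
  proof -
    have "0 \<le> (\<integral>t. exp (- (u * t)) * g t \<partial>lborel)"
      using g_nonneg by (intro integral_nonneg_AE AE_I2) auto
    thus ?thesis using J[OF that] by (simp add: has_bochner_integral_iff)
  qed
  have J_nn: "(\<integral>\<^sup>+t. ennreal (exp (- (u * t)) * g t) \<partial>lborel) = ennreal (J u)" if "u > \<tau>" for u
    using J[OF that] g_nonneg
    by (subst nn_integral_eq_integral) (auto simp: has_bochner_integral_iff intro!: AE_I2)
  have M_fin: "M k < \<infinity>" for k
  proof -
    define u where "u = (\<tau> + s0) / 2"
    have u: "u > \<tau>" "u < s0" using s0 by (auto simp: u_def)
    have "ennreal ((s0 - u) ^ k / fact k) * M k \<le> (\<Sum>k. ennreal ((s0 - u) ^ k / fact k) * M k)"
      using ennreal_suminf_lessD sum_le_suminf[of "\<lambda>k. ennreal ((s0 - u) ^ k / fact k) * M k" "{k}"] by simp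
    also have "\<dots> = ennreal (J u)" using expand[OF u(2)] J_nn[OF u(1)] by simp
    also have "\<dots> < \<infinity>" by simp
    finally have "ennreal ((s0 - u) ^ k / fact k) * M k < \<infinity>" .
    moreover have "(s0 - u) ^ k / fact k > 0" using u by simp
    ultimately show ?thesis using u(2)
      by (auto simp: ennreal_mult_less_top ennreal_mult_eq_top_iff less_top[symmetric])
  qed
  define m where "m = (\<lambda>k. enn2real (M k))"
  have m: "M k = ennreal (m k)" "m k \<ge> 0" for k
    using M_fin[of k] by (auto simp: m_def)
  have m_term: "ennreal ((s0 - u) ^ k / fact k) * M k = ennreal ((s0 - u) ^ k / fact k * m k)" if "u < s0" for u k
    unfolding m(1) using that m(2) by (intro ennreal_mult[symmetric]) auto
  have real_series: "(\<lambda>k. (s0 - u) ^ k / fact k * m k) sums J u" if u: "u > \<tau>" "u < s0" for u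
  proof -
    have nn: "(s0 - u) ^ k / fact k * m k \<ge> 0" for k using u m by auto
    have "(\<Sum>k. ennreal ((s0 - u) ^ k / fact k * m k)) = ennreal (J u)"
      using expand[OF u(2)] J_nn[OF u(1)] by (simp only: m_term[OF u(2)])
    hence "(\<lambda>k. ennreal ((s0 - u) ^ k / fact k * m k)) sums ennreal (J u)"
      by (simp only: sums_iff summableI simp_thms)
    thus ?thesis using sums_ennreal[OF nn J_nonneg[OF u(1)]] by simp
  qed
  define F where "F = Abs_fps (\<lambda>k. complex_of_real ((- 1) ^ k * m k / fact k))"
  have F_term: "fps_nth F k * of_real w ^ k = of_real ((- w) ^ k / fact k * m k)" for k w
    by (simp add: F_def power_minus[of w] mult_ac)
  define \<rho> where "\<rho> = (s0 - \<tau>) / 2"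
  have \<rho>: "\<rho> > 0" "\<rho> < s0" using s0 \<tau> by (auto simp: \<rho>_def)
  have F_eval: "eval_fps F (of_real w) = \<Phi> (of_real s0 + of_real w)" if "w < 0" "w \<ge> - \<rho>" for w
  proof -
    have u: "s0 + w > \<tau>" "s0 + w < s0" using that s0 by (auto simp: \<rho>_def field_simps)
    have "(\<lambda>k. fps_nth F k * of_real w ^ k) sums of_real (J (s0 + w))"
      unfolding F_term using real_series[OF u] by (intro sums_of_real) simp
    thus ?thesis using \<Phi>_J[OF u(1)] by (simp add: eval_fps_def sums_iff)
  qed
  have F_radius: "fps_conv_radius F \<ge> \<rho>"
  proof -
    have "s0 - \<rho> > \<tau>" "s0 - \<rho> < s0" using s0 by (auto simp: \<rho>_def field_simps)
    from real_series[OF this] have "summable (\<lambda>k. \<rho> ^ k / fact k * m k)" by (simp add: sums_iff)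
    hence "summable (\<lambda>k. complex_of_real ((- (- \<rho>)) ^ k / fact k * m k))"
      by (subst summable_complex_of_real) simp
    hence "summable (\<lambda>k. fps_nth F k * complex_of_real (- \<rho>) ^ k)"
      unfolding F_term by simp
    from conv_radius_geI[OF this] show ?thesis using \<rho> by (simp add: fps_conv_radius_def)
  qed
  define f where "f = (\<lambda>w. \<Phi> (of_real s0 + w))"
  have half_plane: "ball (of_real s0) s0 \<subseteq> {z. Re z > 0}"
  proof
    fix z assume "z \<in> ball (complex_of_real s0) s0"
    hence "norm (complex_of_real s0 - z) < s0" by (simp add: dist_norm)
    from le_less_trans[OF abs_Re_le_cmod this] have "\<bar>s0 - Re z\<bar> < s0" by simp
    thus "z \<in> {z. Re z > 0}" by auto
  qed
  have f_hol: "f holomorphic_on ball 0 s0"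
  proof -
    have "\<Phi> \<circ> (\<lambda>w. of_real s0 + w) holomorphic_on ball 0 s0"
    proof (rule holomorphic_on_compose_gen[OF _ hol])
      show "(\<lambda>w. complex_of_real s0 + w) ` ball 0 s0 \<subseteq> {z. Re z > 0}"
        using half_plane by (auto simp: dist_norm subset_iff)
    qed (intro holomorphic_intros)
    thus ?thesis by (simp add: f_def o_def)
  qed
  \<comment> \<open>Both sides agree on a real segment ending at \<open>0\<close>, where the Laplace integral is known.\<close>
  have F_f: "eval_fps F w = f w" if w: "w \<in> ball 0 \<rho>" for w
  proof -
    have "eval_fps F w - f w = 0"
    proof (rule analytic_continuation[of "\<lambda>w. eval_fps F w - f w" "ball 0 \<rho>" "of_real ` {-\<rho><..<0}" 0 w])
      have "eval_fps F holomorphic_on ball 0 \<rho>"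
        using F_radius by (intro holomorphic_on_eval_fps) (auto simp: eball_def intro: less_le_trans[rotated])
      moreover have "f holomorphic_on ball 0 \<rho>"
        using \<rho> by (intro holomorphic_on_subset[OF f_hol]) auto
      ultimately show "(\<lambda>w. eval_fps F w - f w) holomorphic_on ball 0 \<rho>" by (rule holomorphic_on_diff)
      show "(0::complex) islimpt of_real ` {-\<rho><..<0}"
        unfolding islimpt_approachable
      proof (intro allI impI)
        fix e :: real assume e: "e > 0"
        have "- (min \<rho> e / 2) \<in> {-\<rho><..<0}" using e \<rho> by (auto simp: min_def)
        hence "complex_of_real (- (min \<rho> e / 2)) \<in> of_real ` {-\<rho><..<0}" by (rule imageI)
        moreover have "complex_of_real (- (min \<rho> e / 2)) \<noteq> 0" "dist (complex_of_real (- (min \<rho> e / 2))) 0 < e"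
          using e \<rho> by (auto simp: min_def dist_norm norm_divide)
        ultimately show "\<exists>x'\<in>of_real ` {-\<rho><..<0}. x' \<noteq> 0 \<and> dist x' (0::complex) < e" by blast
      qed
      show "eval_fps F z - f z = 0" if "z \<in> of_real ` {-\<rho><..<0}" for z
        using that F_eval by (auto simp: f_def)
    qed (use w \<rho> in \<open>auto\<close>)
    thus ?thesis by simp
  qed
  have "f has_fps_expansion F"
    unfolding has_fps_expansion_def
  proof
    show "fps_conv_radius F > 0" using F_radius \<rho> by (intro less_le_trans[OF _ F_radius]) simp
    have "\<forall>\<^sub>F w in nhds 0. w \<in> ball (0::complex) \<rho>" using \<rho> by (intro eventually_nhds_in_open) auto
    thus "\<forall>\<^sub>F w in nhds 0. eval_fps F w = f w" by eventually_elim (rule F_f)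
  qed
  hence F_exp: "fps_expansion f 0 = F" by (rule fps_expansion_eqI)
  have f_hol': "f holomorphic_on eball 0 (ereal s0)" using f_hol by simp
  have rad: "fps_conv_radius F \<ge> ereal s0"
    using conv_radius_fps_expansion[OF f_hol'] F_exp by simp
  have "eval_fps F (of_real (\<sigma> - s0)) = f (of_real (\<sigma> - s0))"
    using eval_fps_expansion'[OF f_hol', of "of_real (\<sigma> - s0)"] F_exp \<sigma> s0 by (simp add: norm_of_real del: of_real_diff)
  hence ev: "eval_fps F (of_real (\<sigma> - s0)) = \<Phi> (of_real \<sigma>)" by (simp add: f_def)
  have "summable (\<lambda>k. fps_nth F k * of_real (\<sigma> - s0) ^ k)"
    using rad \<sigma> s0 by (intro summable_fps less_le_trans[OF _ rad]) (simp del: of_real_diff)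
  hence "(\<lambda>k. of_real ((s0 - \<sigma>) ^ k / fact k * m k)) sums \<Phi> (of_real \<sigma>)"
    using ev unfolding F_term eval_fps_def sums_iff by simp
  from sums_Re[OF this] have sums_Re: "(\<lambda>k. (s0 - \<sigma>) ^ k / fact k * m k) sums Re (\<Phi> (of_real \<sigma>))"
    by (simp only: Re_complex_of_real)
  have nn: "(s0 - \<sigma>) ^ k / fact k * m k \<ge> 0" for k using s0 m by auto
  show ?thesis
  proof (rule has_bochner_integral_nn_integral)
    show "0 \<le> Re (\<Phi> (of_real \<sigma>))" by (rule sums_le[OF nn sums_zero sums_Re])
    have "(\<integral>\<^sup>+t. ennreal (exp (- (\<sigma> * t)) * g t) \<partial>lborel) = (\<Sum>k. ennreal ((s0 - \<sigma>) ^ k / fact k * m k))"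
      using expand[OF s0(1)] by (simp only: m_term[OF s0(1)])
    also have "\<dots> = ennreal (Re (\<Phi> (of_real \<sigma>)))"
      using sums_Re nn by (intro suminf_ennreal_eq) auto
    finally show "(\<integral>\<^sup>+t. ennreal (exp (- (\<sigma> * t)) * g t) \<partial>lborel) = ennreal (Re (\<Phi> (of_real \<sigma>)))" .
  qed (use g_nonneg in auto)
qed

section \<open>Log-convexity of hypergeometric functions in a parameter shift\<close>

lemma subseq_imp_mset_complement:
  assumes "subseq xs ys"
  obtains zs where "mset ys = mset (zs @ xs)"
proof -
  have "\<exists>zs. mset ys = mset (zs @ xs)" using assms
  proof (induction xs ys rule: list_emb.induct)
    case (list_emb_Nil ys)
    show ?case by (intro exI[of _ ys]) simp
  next
    case (list_emb_Cons xs ys y)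
    then obtain zs where "mset ys = mset (zs @ xs)" by blast
    thus ?case by (intro exI[of _ "y # zs"]) simp
  next
    case (list_emb_Cons2 x y xs ys)
    then obtain zs where "mset ys = mset (zs @ xs)" by blast
    thus ?case using list_emb_Cons2 by (intro exI[of _ zs]) simp
  qed
  thus ?thesis using that by blast
qed

lemma f_hyp_mset_cong:
  assumes "mset a2 = mset a2'"
  shows "f_hyp a1 a2 b1 b2 = f_hyp a1 a2' b1 b2"
proof (intro ext)
  fix \<mu> x
  have ms: "mset (shift \<mu> a2) = mset (shift \<mu> a2')" using assms by (simp add: shift_def)
  have len: "length a2 = length a2'" using assms by (rule mset_eq_length)
  have "(\<Prod>a\<leftarrow>shift \<mu> a2. h a) = (\<Prod>a\<leftarrow>shift \<mu> a2'. h a)" for h :: "real \<Rightarrow> real"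
    using ms by (metis mset_map prod_mset_prod_list)
  note prods = this
  have "hyp_coeff (a1 @ shift \<mu> a2) bs = hyp_coeff (a1 @ shift \<mu> a2') bs" for bs
    by (simp add: hyp_coeff_def fun_eq_iff prods)
  hence "fps_hypergeo (map complex_of_real (a1 @ shift \<mu> a2)) (map complex_of_real bs) 1
       = fps_hypergeo (map complex_of_real (a1 @ shift \<mu> a2')) (map complex_of_real bs) 1" for bs
    unfolding fps_eq_iff fps_hypergeo_of_real by simp
  hence "hypergeo_real (a1 @ shift \<mu> a2) bs x = hypergeo_real (a1 @ shift \<mu> a2') bs x" for bs
    unfolding hypergeo_real_def hypergeo_def continues_series_def using len by (simp add: shift_def)
  thus "f_hyp a1 a2 b1 b2 \<mu> x = f_hyp a1 a2' b1 b2 \<mu> x"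
    unfolding f_hyp_def Gamma_prod_def prods by simp
qed

lemma hypergeo_real_entire:
  assumes "length a1 \<le> length b1"
  shows "hypergeo_real a1 b1 x = Re (\<Sum>k. of_real (hyp_coeff a1 b1 k) * of_real x ^ k)"
  unfolding hypergeo_real_def hypergeo_entire[OF assms] ..

text \<open>
  The discrete form of \<open>f(\<mu>; x) = \<integral> t powr \<mu> * F(a1; b1; x t) d\<nu>(t)\<close>.
\<close>

lemma f_hyp_discrete_limit:
  assumes W: "moment_approx \<delta> W (Gamma_ratio a2 b2)" and \<mu>: "\<mu> \<ge> 0"
    and len2: "length a2 = length b2" and len1: "length a1 \<le> length b1 + 1"
    and x: "length a1 = length b1 + 1 \<Longrightarrow> x < 1"
    and b1: "\<And>b. b \<in> set b1 \<Longrightarrow> b \<notin> \<int>\<^sub>\<le>\<^sub>0"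
    and pos: "\<And>a. a \<in> set a2 \<union> set b2 \<Longrightarrow> a > 0"
  shows "(\<lambda>n. \<Sum>i\<le>n. W n i * (real i / real n) powr (\<delta> + \<mu>) * hypergeo_real a1 b1 (x * (real i / real n)))
           \<longlonglongrightarrow> f_hyp a1 a2 b1 b2 \<mu> x"
proof -
  have pos': "a + \<mu> > 0" if "a \<in> set a2 \<union> set b2" for a using pos[OF that] \<mu> by simp
  have Re_wsum: "Re (\<Sum>i\<le>n. of_real (W n i * (real i / real n) powr (\<delta> + \<mu>)) * G (real i / real n))
      = (\<Sum>i\<le>n. W n i * (real i / real n) powr (\<delta> + \<mu>) * Re (G (real i / real n)))" for n and G :: "real \<Rightarrow> complex"
  proof -
    have "Re (of_real a * z) = a * Re z" for a :: real and z by simp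
    thus ?thesis by (simp only: Re_sum)
  qed
  show ?thesis
  proof (cases "length a1 = length b1 + 1")
    case True
    obtain G where G: "slit_sum (hyp_coeff a1 b1) G" using slit_sum_hyp_coeff[OF True b1] by blast
    obtain H where H: "slit_sum (\<lambda>k. hyp_coeff a1 b1 k * Gamma_ratio a2 b2 (\<mu> + real k)) H"
      and lim: "\<And>z. z \<in> slit_plane \<Longrightarrow>
       (\<lambda>n. \<Sum>i\<le>n. of_real (W n i * (real i / real n) powr (\<delta> + \<mu>)) * G (z * of_real (real i / real n)))
       \<longlonglongrightarrow> H z"
    proof (rule moment_approx_slit_plane[OF W \<mu> G])
      fix H assume "slit_sum (\<lambda>k. hyp_coeff a1 b1 k * Gamma_ratio a2 b2 (\<mu> + real k)) H"
        and "\<And>z. z \<in> slit_plane \<Longrightarrow>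
       (\<lambda>n. \<Sum>i\<le>n. of_real (W n i * (real i / real n) powr (\<delta> + \<mu>)) * G (z * of_real (real i / real n)))
       \<longlonglongrightarrow> H z"
      thus thesis by (rule that)
    qed
    have xs: "complex_of_real x \<in> slit_plane" using x[OF True] by auto
    have g: "Re (G (of_real x * of_real (real i / real n))) = hypergeo_real a1 b1 (x * (real i / real n))"
      if "i \<le> n" for i n
    proof -
      have "of_real x * of_real (real i / real n) \<in> slit_plane"
        by (rule slit_plane_scale[OF xs]) (use that in \<open>auto simp: divide_le_eq_1\<close>)
      thus ?thesis unfolding hypergeo_real_def of_real_mult
        by (subst hypergeo_slit_plane[OF True G]) simp_all
    qed
    have f: "f_hyp a1 a2 b1 b2 \<mu> x = Re (H (of_real x))"
      using True len2 x by (intro f_hyp_slit_plane pos' H) auto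
    have "Re (\<Sum>i\<le>n. of_real (W n i * (real i / real n) powr (\<delta> + \<mu>)) * G (of_real x * of_real (real i / real n)))
        = (\<Sum>i\<le>n. W n i * (real i / real n) powr (\<delta> + \<mu>) * hypergeo_real a1 b1 (x * (real i / real n)))" for n
      unfolding Re_wsum[of n "\<lambda>t. G (of_real x * of_real t)"]
      by (rule sum.cong[OF refl], subst g) auto
    with tendsto_Re[OF lim[OF xs]] show ?thesis unfolding f by (simp only:)
  next
    case False
    hence len: "length a1 \<le> length b1" using len1 by simp
    note lim = moment_approx_series(2)[OF W \<mu> hyp_coeff_abs_summable[OF len], of "of_real x"]
    have g: "Re (\<Sum>k. of_real (hyp_coeff a1 b1 k) * (of_real x * of_real t) ^ k) = hypergeo_real a1 b1 (x * t)" for t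
      unfolding hypergeo_real_entire[OF len] of_real_mult ..
    have f: "f_hyp a1 a2 b1 b2 \<mu> x = (\<Sum>k. hyp_coeff a1 b1 k * Gamma_ratio a2 b2 (\<mu> + real k) * x ^ k)"
      and sm: "summable (\<lambda>k. \<bar>hyp_coeff a1 b1 k * Gamma_ratio a2 b2 (\<mu> + real k) * x ^ k\<bar>)"
      using f_hyp_entire[of a1 a2 b1 b2 \<mu> x] len len2 pos' by auto
    have "(\<Sum>k. complex_of_real (hyp_coeff a1 b1 k * Gamma_ratio a2 b2 (\<mu> + real k)) * of_real x ^ k)
        = of_real (f_hyp a1 a2 b1 b2 \<mu> x)"
      unfolding f using suminf_of_real[OF summable_rabs_cancel[OF sm], where ?'a = complex] by simp
    with tendsto_Re[OF lim] show ?thesis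
      unfolding Re_wsum[of _ "\<lambda>t. (\<Sum>k. of_real (hyp_coeff a1 b1 k) * (of_real x * of_real t) ^ k)"] g
      by (simp only: Re_complex_of_real)
  qed
qed

text \<open>
  The last grid point is \<open>1\<close>, while the sign is known for \<open>t < 1\<close> only; it extends by continuity of the continuation.
\<close>

lemma hypergeo_real_nonneg_at_1:
  assumes "length a1 = length b1 + 1" "\<And>b. b \<in> set b1 \<Longrightarrow> b \<notin> \<int>\<^sub>\<le>\<^sub>0" "x < 1"
    and nonneg: "\<And>t. 0 < t \<Longrightarrow> t < 1 \<Longrightarrow> hypergeo_real a1 b1 (x * t) \<ge> 0"
  shows "hypergeo_real a1 b1 x \<ge> 0"
proof -
  obtain G where G: "slit_sum (hyp_coeff a1 b1) G" using slit_sum_hyp_coeff[OF assms(1,2)] by blast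
  have xs: "complex_of_real x \<in> slit_plane" using assms(3) by auto
  have eq: "hypergeo_real a1 b1 y = Re (G (of_real y))" if "y < 1" for y
    unfolding hypergeo_real_def using that by (subst hypergeo_slit_plane[OF assms(1) G]) auto
  have "isCont G (of_real x)"
    using G xs open_slit_plane
    by (auto simp: slit_sum_def intro: continuous_on_interior[OF holomorphic_on_imp_continuous_on] simp: interior_open)
  moreover have "((\<lambda>t. complex_of_real (x * t)) \<longlongrightarrow> of_real (x * 1)) (at_left 1)"
    by (intro tendsto_intros)
  ultimately have "((\<lambda>t. Re (G (of_real (x * t)))) \<longlongrightarrow> Re (G (of_real x))) (at_left 1)"
    by (intro tendsto_Re isCont_tendsto_compose[of _ G]) auto
  moreover have "\<forall>\<^sub>F t in at_left (1::real). t \<in> {0<..<1}" by (rule eventually_at_left_real) simp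
  hence "\<forall>\<^sub>F t in at_left 1. Re (G (of_real (x * t))) \<ge> 0"
  proof eventually_elim
    case (elim t)
    hence "x * t < 1"
    proof (cases "x \<le> 0")
      case True
      hence "x * t \<le> 0" using elim by (simp add: mult_nonpos_nonneg)
      thus ?thesis by simp
    next
      case False
      hence "x * t \<le> x * 1" using elim by (intro mult_left_mono) auto
      thus ?thesis using assms(3) by simp
    qed
    from eq[OF this] nonneg[of t] elim show ?case by simp
  qed
  ultimately have "0 \<le> Re (G (of_real x))" by (rule tendsto_lowerbound) simp
  thus ?thesis using eq[OF assms(3)] by simp
qed

text \<open>
  For equally many shifted parameters above and below, the function is a limit of nonnegative combinations of the functions
  \<open>\<mu> \<mapsto> (i / n) powr (\<delta> + \<mu>)\<close>, each of which is log-linear and decreasing in \<open>\<mu>\<close>.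
\<close>

lemma f_hyp_balanced:
  assumes len2: "length a2 = length b2" and len1: "length a1 \<le> length b1 + 1"
    and x: "length a1 = length b1 + 1 \<Longrightarrow> x < 1"
    and b: "\<And>b. b \<in> set b1 \<union> set b2 \<Longrightarrow> b \<notin> \<int>\<^sub>\<le>\<^sub>0"
    and a2: "\<And>a. a \<in> set a2 \<Longrightarrow> a > 0"
    and v: "\<And>t. 0 \<le> t \<Longrightarrow> t \<le> 1 \<Longrightarrow> v_fun a2 b2 t \<ge> 0"
    and nonneg: "\<And>t. 0 < t \<Longrightarrow> t < 1 \<Longrightarrow> hypergeo_real a1 b1 (x * t) \<ge> 0"
    and nonneg_1: "length a1 \<le> length b1 \<Longrightarrow> hypergeo_real a1 b1 x \<ge> 0"
  shows "log_convex_on {0..} (\<lambda>\<mu>. f_hyp a1 a2 b1 b2 \<mu> x)"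
    and "\<And>\<mu> \<nu>. 0 \<le> \<mu> \<Longrightarrow> \<mu> \<le> \<nu> \<Longrightarrow> f_hyp a1 a2 b1 b2 \<nu> x \<le> f_hyp a1 a2 b1 b2 \<mu> x"
proof -
  have b2: "0 \<notin> set b2" using b by auto
  obtain \<delta> W where W: "moment_approx \<delta> W (Gamma_ratio a2 b2)"
    by (rule Gamma_ratio_discrete_approx[OF len2 a2 b2 v])
  then obtain C where \<delta>: "\<delta> > 0" and W0: "\<And>n i. i \<le> n \<Longrightarrow> W n i \<ge> 0"
    by (rule moment_approxE) blast
  have pos: "c > 0" if "c \<in> set a2 \<union> set b2" for c
    using that a2 v_fun_nonneg_imp_pos[OF len2 a2 b2 v] by auto
  define g where "g = (\<lambda>n i. hypergeo_real a1 b1 (x * (real i / real n)))"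
  have lim: "(\<lambda>n. \<Sum>i\<le>n. W n i * (real i / real n) powr (\<delta> + \<mu>) * g n i) \<longlonglongrightarrow> f_hyp a1 a2 b1 b2 \<mu> x"
    if "\<mu> \<ge> 0" for \<mu>
    unfolding g_def using b by (intro f_hyp_discrete_limit[OF W that len2 len1 x _ pos]) auto
  have one: "hypergeo_real a1 b1 x \<ge> 0"
    using len1 nonneg_1 hypergeo_real_nonneg_at_1[of a1 b1 x] b x nonneg
    by (cases "length a1 \<le> length b1") auto
  have g: "g n i \<ge> 0" if "i \<noteq> 0" "i \<le> n" for n i
  proof (cases "i = n")
    case True
    thus ?thesis using one that by (simp add: g_def)
  next
    case False
    thus ?thesis unfolding g_def using that by (intro nonneg) auto
  qed
  have coeff: "W n i * g n i \<ge> 0" if "i \<noteq> 0" "i \<le> n" for n i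
    using that by (intro mult_nonneg_nonneg W0 g)
  \<comment> \<open>At \<open>i = 0\<close>, where \<open>g n i\<close> is the value at \<open>0\<close>, the power of \<open>0\<close> vanishes.\<close>
  have term_eq: "W n i * (real i / real n) powr (\<delta> + \<mu>) * g n i
      = (if i = 0 then 0 else W n i * g n i) * (real i / real n) powr (\<delta> + \<mu>)" for n i \<mu>
    by simp
  show "log_convex_on {0..} (\<lambda>\<mu>. f_hyp a1 a2 b1 b2 \<mu> x)"
  proof (rule log_convex_on_limit)
    show "log_convex_on {0..} (\<lambda>\<mu>. \<Sum>i\<le>n. W n i * (real i / real n) powr (\<delta> + \<mu>) * g n i)" for n
      unfolding term_eq
      by (intro log_convex_on_sum log_convex_on_mult log_convex_on_const log_convex_on_powr)
         (use coeff in \<open>auto simp: convex_real_interval\<close>)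
  qed (use lim in auto)
  fix \<mu> \<nu> :: real assume \<mu>: "0 \<le> \<mu>" "\<mu> \<le> \<nu>"
  show "f_hyp a1 a2 b1 b2 \<nu> x \<le> f_hyp a1 a2 b1 b2 \<mu> x"
  proof (rule LIMSEQ_le[OF lim lim])
    show "\<exists>N. \<forall>n\<ge>N. (\<Sum>i\<le>n. W n i * (real i / real n) powr (\<delta> + \<nu>) * g n i)
        \<le> (\<Sum>i\<le>n. W n i * (real i / real n) powr (\<delta> + \<mu>) * g n i)"
      unfolding term_eq
    proof (intro exI allI impI sum_mono mult_left_mono)
      fix n i :: nat assume "i \<in> {..n}"
      thus "(real i / real n) powr (\<delta> + \<nu>) \<le> (real i / real n) powr (\<delta> + \<mu>)"
        using \<mu> by (intro powr_mono') (auto simp: divide_le_eq_1)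
      show "0 \<le> (if i = 0 then 0 else W n i * g n i)" using coeff \<open>i \<in> {..n}\<close> by auto
    qed
  qed (use \<mu> in auto)
qed

lemma Gamma_ratio_Cons: "Gamma_ratio (e # as) bs s = Gamma (e + s) * Gamma_ratio as bs s"
  by (simp add: Gamma_ratio_def Gamma_prod_def shift_def)

text \<open>
  An additional shifted numerator parameter \<open>e\<close> multiplies the \<open>k\<close>-th coefficient by \<open>\<Gamma>(e + \<mu> + k)\<close>, which
  is a Gamma integral.  Here the numerator is short enough that the series still converges everywhere.
\<close>

lemma f_hyp_gamma_step_entire:
  assumes len: "length a1 + length (e # as) \<le> length b1 + length bs"
    and pos: "\<And>a. a \<in> set (e # as) \<union> set bs \<Longrightarrow> a > 0" and \<mu>: "\<mu> \<ge> 0"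
  shows "has_bochner_integral lborel (\<lambda>t. gamma_kernel (e + \<mu>) 1 t * f_hyp a1 as b1 bs \<mu> (x * t))
           (f_hyp a1 (e # as) b1 bs \<mu> x)"
proof -
  define c where "c = (\<lambda>k. hyp_coeff a1 b1 k * Gamma_ratio as bs (\<mu> + real k) * x ^ k)"
  have pos': "a + \<mu> > 0" if "a \<in> set (e # as) \<union> set bs" for a using pos[OF that] \<mu> by simp
  have c_t: "c k * t ^ k = hyp_coeff a1 b1 k * Gamma_ratio as bs (\<mu> + real k) * (x * t) ^ k" for k t
    by (simp add: c_def power_mult_distrib)
  have c_\<Gamma>: "c k * Gamma (e + \<mu> + real k) / 1 ^ k = hyp_coeff a1 b1 k * Gamma_ratio (e # as) bs (\<mu> + real k) * x ^ k" for k
    by (simp add: c_def Gamma_ratio_Cons add_ac)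
  have inner: "summable (\<lambda>k. \<bar>c k * t ^ k\<bar>)" "f_hyp a1 as b1 bs \<mu> (x * t) = (\<Sum>k. c k * t ^ k)" for t
    unfolding c_t using f_hyp_entire[of a1 as b1 bs \<mu> "x * t"] len pos' by auto
  have outer: "summable (\<lambda>k. \<bar>c k * Gamma (e + \<mu> + real k) / 1 ^ k\<bar>)"
    "f_hyp a1 (e # as) b1 bs \<mu> x = (\<Sum>k. c k * Gamma (e + \<mu> + real k) / 1 ^ k)"
    unfolding c_\<Gamma> by (intro f_hyp_entire len pos'; simp)+
  have "e + \<mu> > 0" using pos' by simp
  from gamma_kernel_series[OF this zero_less_one inner(1) outer(1)]
  show ?thesis unfolding inner(2) outer(2) by simp
qed

text \<open>
  If the additional parameter \<open>e\<close> brings the numerator to its maximal length, the resulting series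
  converges in the unit disk only.  For \<open>\<bar>x\<bar> < 1\<close> termwise integration still works.  For \<open>x \<le> - 1\<close>, termwise integration
  gives the integral with \<open>exp (- \<sigma> t)\<close> in place of \<open>exp (- t)\<close> as long as \<open>\<sigma> > \<bar>x\<bar>\<close>; its value is
  \<open>\<sigma> powr (- A) * H (x / \<sigma>)\<close> with the continued function \<open>H\<close>.  This is holomorphic for \<open>Re \<sigma> > 0\<close> since \<open>x / \<sigma>\<close> then avoids the slit, and
  Landau's theorem leads from large \<open>\<sigma>\<close> down to \<open>\<sigma> = 1\<close>.
\<close>

lemma f_hyp_gamma_step_slit:
  assumes len: "length a1 + length (e # as) = length b1 + length bs + 1"
    and pos: "\<And>a. a \<in> set (e # as) \<union> set bs \<Longrightarrow> a > 0" and \<mu>: "\<mu> \<ge> 0"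
    and b1: "\<And>b. b \<in> set b1 \<Longrightarrow> b \<notin> \<int>\<^sub>\<le>\<^sub>0" and x: "x < 1"
    and nonneg: "\<And>t. t > 0 \<Longrightarrow> f_hyp a1 as b1 bs \<mu> (x * t) \<ge> 0"
  shows "has_bochner_integral lborel (\<lambda>t. gamma_kernel (e + \<mu>) 1 t * f_hyp a1 as b1 bs \<mu> (x * t))
           (f_hyp a1 (e # as) b1 bs \<mu> x)"
proof -
  define A where "A = e + \<mu>"
  \<comment> \<open>\<open>c\<close> and \<open>d\<close> are the coefficients before and after the step; \<open>c\<close> contains the powers of \<open>x\<close>.\<close>
  define d where "d = (\<lambda>k. hyp_coeff a1 b1 k * Gamma_ratio (e # as) bs (\<mu> + real k))"
  define c where "c = (\<lambda>k. hyp_coeff a1 b1 k * Gamma_ratio as bs (\<mu> + real k) * x ^ k)"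
  have pos': "a + \<mu> > 0" if "a \<in> set (e # as) \<union> set bs" for a using pos[OF that] \<mu> by simp
  have A: "A > 0" using pos' by (simp add: A_def)
  have c_t: "c k * t ^ k = hyp_coeff a1 b1 k * Gamma_ratio as bs (\<mu> + real k) * (x * t) ^ k" for k t
    by (simp add: c_def power_mult_distrib)
  have c_d: "c k * Gamma (A + real k) / \<sigma> ^ k = d k * (x / \<sigma>) ^ k" for k \<sigma>
    by (simp add: c_def d_def A_def Gamma_ratio_Cons add_ac power_divide)
  have inner: "summable (\<lambda>k. \<bar>c k * t ^ k\<bar>)" "f_hyp a1 as b1 bs \<mu> (x * t) = (\<Sum>k. c k * t ^ k)" for t
    unfolding c_t using f_hyp_entire[of a1 as b1 bs \<mu> "x * t"] len pos' by auto
  obtain H where H: "slit_sum d H"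
    using f_hyp_slit_sum[of a1 "e # as" b1 bs \<mu>] len pos' b1 unfolding d_def by auto
  have f_H: "f_hyp a1 (e # as) b1 bs \<mu> x = Re (H (of_real x))"
    using H len unfolding d_def by (intro f_hyp_slit_plane pos' x) auto
  have H_hol: "H holomorphic_on slit_plane" using H by (simp add: slit_sum_def)
  have transform: "has_bochner_integral lborel (\<lambda>t. gamma_kernel A \<sigma> t * f_hyp a1 as b1 bs \<mu> (x * t))
      (\<sigma> powr (- A) * Re (H (of_real (x / \<sigma>))))" and real: "H (of_real (x / \<sigma>)) = of_real (Re (H (of_real (x / \<sigma>))))"
    if \<sigma>: "\<sigma> > 0" "\<bar>x\<bar> < \<sigma>" for \<sigma>
  proof -
    have small: "norm (complex_of_real (x / \<sigma>)) < 1" using \<sigma> by (simp add: abs_divide del: of_real_divide)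
    have "summable (\<lambda>k. norm (complex_of_real (d k) * of_real (x / \<sigma>) ^ k))"
      by (rule slit_sum_abs_summable[OF H small])
    also have "(\<lambda>k. norm (complex_of_real (d k) * of_real (x / \<sigma>) ^ k)) = (\<lambda>k. \<bar>d k * (x / \<sigma>) ^ k\<bar>)"
      by (simp only: norm_mult norm_power norm_of_real abs_mult power_abs)
    finally have sm: "summable (\<lambda>k. \<bar>d k * (x / \<sigma>) ^ k\<bar>)" .
    have "(\<lambda>k. complex_of_real (d k) * of_real (x / \<sigma>) ^ k) sums H (of_real (x / \<sigma>))"
      using H small by (simp add: slit_sum_def del: of_real_divide)
    moreover have "(\<lambda>k. complex_of_real (d k) * of_real (x / \<sigma>) ^ k) sums of_real (\<Sum>k. d k * (x / \<sigma>) ^ k)"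
      using sums_of_real[OF summable_sums[OF summable_rabs_cancel[OF sm]], where ?'a = complex]
      by (simp only: of_real_mult of_real_power)
    ultimately have Heq: "H (of_real (x / \<sigma>)) = of_real (\<Sum>k. d k * (x / \<sigma>) ^ k)" by (rule sums_unique2)
    thus "H (of_real (x / \<sigma>)) = of_real (Re (H (of_real (x / \<sigma>))))" by (simp only: Re_complex_of_real)
    show "has_bochner_integral lborel (\<lambda>t. gamma_kernel A \<sigma> t * f_hyp a1 as b1 bs \<mu> (x * t))
      (\<sigma> powr (- A) * Re (H (of_real (x / \<sigma>))))"
      using gamma_kernel_series[OF A \<sigma>(1) inner(1), unfolded c_d, OF sm]
      unfolding inner(2) Heq Re_complex_of_real .
  qed
  show ?thesis
  proof (cases "\<bar>x\<bar> < 1")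
    case True
    thus ?thesis using transform[of 1] by (simp add: f_H A_def)
  next
    case False
    hence x0: "x < 0" using x by simp
    define g where "g = (\<lambda>t. gamma_kernel A 0 t * f_hyp a1 as b1 bs \<mu> (x * t))"
    define \<Phi> where "\<Phi> = (\<lambda>z. z powr of_real (- A) * H (of_real x / z))"
    have ker: "exp (- (\<sigma> * t)) * g t = gamma_kernel A \<sigma> t * f_hyp a1 as b1 bs \<mu> (x * t)" for \<sigma> t
      by (simp add: g_def gamma_kernel_def)
    have \<Phi>_real: "\<Phi> (of_real \<sigma>) = of_real (\<sigma> powr (- A)) * H (of_real (x / \<sigma>))" if "\<sigma> > 0" for \<sigma>
      unfolding \<Phi>_def using that by (subst powr_of_real) auto
    have "has_bochner_integral lborel (\<lambda>t. exp (- (1 * t)) * g t) (Re (\<Phi> (of_real 1)))"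
    proof (rule landau_laplace[where \<tau> = "\<bar>x\<bar>"])
      show "g \<in> borel_measurable borel"
        unfolding g_def inner(2) by measurable
      show "g t \<ge> 0" for t
        using nonneg gamma_kernel_nonneg by (cases "t > 0") (auto simp: g_def gamma_kernel_def)
      show "g t = 0" if "t \<le> 0" for t using that by (simp add: g_def gamma_kernel_def)
      show "\<Phi> holomorphic_on {z. Re z > 0}"
      proof -
        have sub: "of_real x / z \<in> slit_plane" if "Re z > 0" for z
        proof
          assume "complex_of_real x / z \<in> complex_of_real ` {1..}"
          then obtain r where r: "r \<ge> 1" "complex_of_real x / z = of_real r" by auto
          have "z \<noteq> 0" using that by auto
          hence "of_real r * z = of_real x" using r by (simp add: field_simps)
          hence "Re (of_real r * z) = x" by simp
          hence "r * Re z = x" by simp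
          moreover have "r * Re z > 0" using r that by simp
          ultimately show False using x0 by simp
        qed
        have "(\<lambda>z. of_real x / z) holomorphic_on {z. Re z > 0}"
          by (intro holomorphic_intros) auto
        from holomorphic_on_compose_gen[OF this H_hol]
        have "(\<lambda>z. H (of_real x / z)) holomorphic_on {z. Re z > 0}"
          using sub by (simp add: o_def image_subset_iff)
        moreover have "(\<lambda>z. z powr of_real (- A)) holomorphic_on {z. Re z > 0}"
          by (intro holomorphic_intros) (auto simp: complex_nonpos_Reals_iff)
        ultimately show ?thesis unfolding \<Phi>_def by (intro holomorphic_on_mult)
      qed
      show "has_bochner_integral lborel (\<lambda>t. exp (- (\<sigma> * t)) * g t) (\<sigma> powr (- A) * Re (H (of_real (x / \<sigma>))))"
        if "\<bar>x\<bar> < \<sigma>" for \<sigma>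
        unfolding ker using that by (intro transform) auto
      show "\<Phi> (of_real \<sigma>) = of_real (\<sigma> powr (- A) * Re (H (of_real (x / \<sigma>))))" if "\<bar>x\<bar> < \<sigma>" for \<sigma>
        using \<Phi>_real[of \<sigma>] real[of \<sigma>] that by (simp only: of_real_mult)
    qed (use x0 in auto)
    thus ?thesis unfolding ker using \<Phi>_real[of 1] by (simp add: f_H A_def)
  qed
qed

lemma log_convex_gamma_kernel: "log_convex_on {0..} (\<lambda>\<mu>. gamma_kernel (e + \<mu>) \<sigma> t)"
proof -
  have "log_convex_on {0..} (\<lambda>\<mu>. indicator {0<..} t * (\<bar>t\<bar> powr (e - 1 + \<mu>) * exp (- (\<sigma> * t))))"
    by (intro log_convex_on_mult log_convex_on_const log_convex_on_powr) auto
  also have "(\<lambda>\<mu>. indicator {0<..} t * (\<bar>t\<bar> powr (e - 1 + \<mu>) * exp (- (\<sigma> * t)))) = (\<lambda>\<mu>. gamma_kernel (e + \<mu>) \<sigma> t)"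
    by (auto simp: gamma_kernel_def fun_eq_iff indicator_def algebra_simps)
  finally show ?thesis .
qed

lemma log_convex_gamma_step:
  assumes "\<And>\<mu>. \<mu> \<ge> 0 \<Longrightarrow> has_bochner_integral lborel
             (\<lambda>t. gamma_kernel (e + \<mu>) 1 t * F \<mu> t) (f \<mu>)"
    and "\<And>t. t > 0 \<Longrightarrow> log_convex_on {0..} (\<lambda>\<mu>. F \<mu> t)"
  shows "log_convex_on {0..} f"
proof -
  have "log_convex_on {0..} (\<lambda>\<mu>. \<integral>t. gamma_kernel (e + \<mu>) 1 t * F \<mu> t \<partial>lborel)"
  proof (rule log_convex_on_integral)
    fix t :: real
    show "log_convex_on {0..} (\<lambda>\<mu>. gamma_kernel (e + \<mu>) 1 t * F \<mu> t)"
    proof (cases "t > 0")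
      case True
      thus ?thesis by (intro log_convex_on_mult log_convex_gamma_kernel assms(2))
    next
      case False
      hence "(\<lambda>\<mu>. gamma_kernel (e + \<mu>) 1 t * F \<mu> t) = (\<lambda>_. 0)" by (simp add: gamma_kernel_def)
      thus ?thesis by (simp add: log_convex_on_const)
    qed
  qed (use assms(1) in \<open>auto simp: has_bochner_integral_iff\<close>)
  moreover have "(\<integral>t. gamma_kernel (e + \<mu>) 1 t * F \<mu> t \<partial>lborel) = f \<mu>" if "\<mu> \<in> {0..}" for \<mu>
    using assms(1)[of \<mu>] that by (simp add: has_bochner_integral_iff)
  ultimately show ?thesis unfolding log_convex_on_def
    by (simp add: convex_real_interval)
qed

text \<open>
  Induction over the numerator parameters \<open>E\<close> that have no partner in \<open>b2\<close>.  The argument \<open>x\<close> is generalized because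
  each step integrates over \<open>x t\<close> for all \<open>t > 0\<close>.
\<close>

lemma f_hyp_log_convex_entire:
  assumes len2: "length a2 = length b2" and len: "length a1 + length E \<le> length b1"
    and b: "\<And>b. b \<in> set b1 \<union> set b2 \<Longrightarrow> b \<notin> \<int>\<^sub>\<le>\<^sub>0"
    and pos: "\<And>a. a \<in> set E \<union> set a2 \<Longrightarrow> a > 0"
    and v: "\<And>t. 0 \<le> t \<Longrightarrow> t \<le> 1 \<Longrightarrow> v_fun a2 b2 t \<ge> 0"
    and nonneg: "\<And>t. 0 < t \<Longrightarrow> hypergeo_real a1 b1 (x * t) \<ge> 0"
  shows "log_convex_on {0..} (\<lambda>\<mu>. f_hyp a1 (E @ a2) b1 b2 \<mu> x)"
  using len pos nonneg
proof (induction E arbitrary: x)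
  case Nil
  show ?case unfolding append_Nil
    by (rule f_hyp_balanced(1)[OF len2 _ _ b _ v]) (use Nil Nil(3)[of 1] in auto)
next
  case (Cons e E)
  have b2: "0 \<notin> set b2" using b by auto
  have a2: "a > 0" if "a \<in> set a2" for a using Cons.prems(2) that by auto
  have b2_pos: "c > 0" if "c \<in> set b2" for c
    by (rule v_fun_nonneg_imp_pos[OF len2 a2 b2 v that])
  show ?case unfolding append_Cons
  proof (rule log_convex_gamma_step)
    show "has_bochner_integral lborel (\<lambda>t. gamma_kernel (e + \<mu>) 1 t * f_hyp a1 (E @ a2) b1 b2 \<mu> (x * t))
           (f_hyp a1 (e # E @ a2) b1 b2 \<mu> x)" if "\<mu> \<ge> 0" for \<mu>
      by (rule f_hyp_gamma_step_entire[OF _ _ that]) (use Cons.prems len2 b2_pos in auto)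
    show "log_convex_on {0..} (\<lambda>\<mu>. f_hyp a1 (E @ a2) b1 b2 \<mu> (x * t))" if "t > 0" for t
      using Cons.prems that by (intro Cons.IH) (auto simp: mult.assoc)
  qed
qed

text \<open>
  All components of \<open>E\<close> but the first leave the series convergent everywhere.
\<close>

lemma f_hyp_log_convex_extra:
  assumes len2: "length a2 = length b2" and len: "length a1 + length E \<le> length b1 + 1" and "E \<noteq> []"
    and b: "\<And>b. b \<in> set b1 \<union> set b2 \<Longrightarrow> b \<notin> \<int>\<^sub>\<le>\<^sub>0"
    and pos: "\<And>a. a \<in> set E \<union> set a2 \<Longrightarrow> a > 0"
    and v: "\<And>t. 0 \<le> t \<Longrightarrow> t \<le> 1 \<Longrightarrow> v_fun a2 b2 t \<ge> 0"
    and x: "length a1 + length E = length b1 + 1 \<Longrightarrow> x < 1"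
    and nonneg: "\<And>t. 0 < t \<Longrightarrow> hypergeo_real a1 b1 (x * t) \<ge> 0"
  shows "log_convex_on {0..} (\<lambda>\<mu>. f_hyp a1 (E @ a2) b1 b2 \<mu> x)"
proof (cases "length a1 + length E = length b1 + 1")
  case False
  show ?thesis by (rule f_hyp_log_convex_entire[OF len2 _ b pos v nonneg]) (use False len in auto)
next
  case True
  obtain e E' where E: "E = e # E'" using \<open>E \<noteq> []\<close> by (cases E) auto
  have b2: "0 \<notin> set b2" using b by auto
  have a2: "a > 0" if "a \<in> set a2" for a using pos that by auto
  have b2_pos: "c > 0" if "c \<in> set b2" for c
    by (rule v_fun_nonneg_imp_pos[OF len2 a2 b2 v that])
  have lc: "log_convex_on {0..} (\<lambda>\<mu>. f_hyp a1 (E' @ a2) b1 b2 \<mu> (x * t))" if "t > 0" for t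
  proof (rule f_hyp_log_convex_entire[OF len2 _ b _ v])
    show "hypergeo_real a1 b1 (x * t * u) \<ge> 0" if "u > 0" for u
      using nonneg[of "t * u"] that \<open>t > 0\<close> by (simp add: mult.assoc)
  qed (use True pos in \<open>auto simp: E\<close>)
  show ?thesis unfolding E append_Cons
  proof (rule log_convex_gamma_step[OF _ lc])
    fix \<mu> :: real assume \<mu>: "\<mu> \<ge> 0"
    show "has_bochner_integral lborel (\<lambda>t. gamma_kernel (e + \<mu>) 1 t * f_hyp a1 (E' @ a2) b1 b2 \<mu> (x * t))
           (f_hyp a1 (e # E' @ a2) b1 b2 \<mu> x)"
    proof (rule f_hyp_gamma_step_slit[OF _ _ \<mu>])
      show "f_hyp a1 (E' @ a2) b1 b2 \<mu> (x * t) \<ge> 0" if "t > 0" for t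
        using log_convex_on_nonneg[OF lc[OF that]] \<mu> by simp
    qed (use True len2 b pos b2_pos x in \<open>auto simp: E\<close>)
  qed
qed

theorem theorem1:
  fixes p1 p2 q1 q2 p q :: nat
    and a1 a2 b1 b2 :: "real list"
    and x :: real
  assumes "p1 \<le> q1 + 1" and "p2 \<ge> 1" and "q2 \<le> p2" and "p1 + p2 \<le> q1 + q2 + 1"
    and "p = p1 + p2" and "q = q1 + q2"
    and "length a1 = p1" and "length a2 = p2" and "length b1 = q1" and "length b2 = q2"
    and "\<forall>b\<in>set b1 \<union> set b2. b \<notin> \<int>\<^sub>\<le>\<^sub>0"
    and "\<forall>a\<in>set a2. a > 0"
    and "\<exists>a2'. subseq a2' a2 \<and> length a2' = q2 \<and> (\<forall>t\<in>{0..1}. v_fun a2' b2 t \<ge> 0)"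
    and "p = q + 1 \<longrightarrow> x < 1"
    and "p1 \<le> q1 \<longrightarrow> (\<forall>t>0. hypergeo_real a1 b1 (x * t) \<ge> 0)"
    and "p1 = q1 + 1 \<longrightarrow> (\<forall>t. 0 < t \<and> t < 1 \<longrightarrow> hypergeo_real a1 b1 (x * t) \<ge> 0)"
  defines "f \<equiv> f_hyp a1 a2 b1 b2"
  shows "(\<forall>\<alpha>>0. \<forall>\<beta>>0. \<forall>\<mu>\<ge>0.
            0 \<le> f \<mu> x * f (\<mu> + \<alpha> + \<beta>) x - f (\<mu> + \<alpha>) x * f (\<mu> + \<beta>) x)
       \<and> log_convex_on {0..} (\<lambda>\<mu>. f \<mu> x)
       \<and> (p2 = q2 \<longrightarrow> (\<forall>\<alpha>>0. \<forall>\<beta>>0. \<forall>\<mu>\<ge>0.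
            f \<mu> x * f (\<mu> + \<alpha> + \<beta>) x - f (\<mu> + \<alpha>) x * f (\<mu> + \<beta>) x \<le> 1 / 4 * (f \<mu> x)\<^sup>2))"
proof -
  obtain a2' where sub: "subseq a2' a2" and len2: "length a2' = length b2"
    and v: "\<And>t. 0 \<le> t \<Longrightarrow> t \<le> 1 \<Longrightarrow> v_fun a2' b2 t \<ge> 0"
    using assms by auto
  have b: "b \<notin> \<int>\<^sub>\<le>\<^sub>0" if "b \<in> set b1 \<union> set b2" for b using assms(11) that by blast
  have nonneg: "hypergeo_real a1 b1 (x * t) \<ge> 0" if "0 < t" "t < 1" for t
    using assms(1,15,16) that by (cases "p1 \<le> q1") auto
  have nonneg_1: "hypergeo_real a1 b1 x \<ge> 0" if "length a1 \<le> length b1"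
  proof -
    have "hypergeo_real a1 b1 (x * 1) \<ge> 0" using assms(7,9,15) that by (metis zero_less_one)
    thus ?thesis by simp
  qed
  have balanced: "log_convex_on {0..} (\<lambda>\<mu>. f \<mu> x)"
      "\<And>\<mu> \<nu>. 0 \<le> \<mu> \<Longrightarrow> \<mu> \<le> \<nu> \<Longrightarrow> f \<nu> x \<le> f \<mu> x" if "p2 = q2"
  proof -
    have "a2' = a2" using subseq_same_length[OF sub] len2 assms(8,10) that by simp
    hence len2': "length a2 = length b2" and v': "\<And>t. 0 \<le> t \<Longrightarrow> t \<le> 1 \<Longrightarrow> v_fun a2 b2 t \<ge> 0"
      using len2 v by simp_all
    have x: "length a1 = length b1 + 1 \<Longrightarrow> x < 1" using assms(5-10,14) that by simp
    have len1: "length a1 \<le> length b1 + 1" using assms(1,7,9) by simp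
    have a2: "a > 0" if "a \<in> set a2" for a using assms(12) that by blast
    note bal = f_hyp_balanced[OF len2' len1 x b a2 v' nonneg nonneg_1]
    show "log_convex_on {0..} (\<lambda>\<mu>. f \<mu> x)" unfolding f_def by (rule bal(1))
    show "\<And>\<mu> \<nu>. 0 \<le> \<mu> \<Longrightarrow> \<mu> \<le> \<nu> \<Longrightarrow> f \<nu> x \<le> f \<mu> x" unfolding f_def by (rule bal(2))
  qed
  have lc: "log_convex_on {0..} (\<lambda>\<mu>. f \<mu> x)"
  proof (cases "p2 = q2")
    case True
    thus ?thesis by (rule balanced(1))
  next
    case False
    obtain E where E: "mset a2 = mset (E @ a2')" using subseq_imp_mset_complement[OF sub] by blast
    have len_E: "p2 = length E + q2"
      using mset_eq_length[OF E] assms(8,10) len2 by simp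
    have set_E: "set E \<union> set a2' = set a2" using mset_eq_setD[OF E] by simp
    have "log_convex_on {0..} (\<lambda>\<mu>. f_hyp a1 (E @ a2') b1 b2 \<mu> x)"
    proof (rule f_hyp_log_convex_extra[OF len2 _ _ b _ v])
      show "length a1 + length E \<le> length b1 + 1" using assms(4,7,9) len_E by simp
      show "E \<noteq> []" using False len_E by auto
      show "a > 0" if "a \<in> set E \<union> set a2'" for a using assms(12) that set_E by blast
      show "x < 1" if "length a1 + length E = length b1 + 1" using that assms(5-10,14) len_E by simp
      have "p1 \<le> q1" using False assms(3,4) by simp
      thus "hypergeo_real a1 b1 (x * t) \<ge> 0" if "0 < t" for t using assms(15) that by blast
    qed
    thus ?thesis unfolding f_def f_hyp_mset_cong[OF E] .
  qed
  show ?thesis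
  proof (intro conjI allI impI)
    fix \<alpha> \<beta> \<mu> :: real assume *: "\<alpha> > 0" "\<beta> > 0" "\<mu> \<ge> 0"
    show "0 \<le> f \<mu> x * f (\<mu> + \<alpha> + \<beta>) x - f (\<mu> + \<alpha>) x * f (\<mu> + \<beta>) x"
      using log_convex_imp_four_point[OF lc *] by simp
    assume "p2 = q2"
    thus "f \<mu> x * f (\<mu> + \<alpha> + \<beta>) x - f (\<mu> + \<alpha>) x * f (\<mu> + \<beta>) x \<le> 1 / 4 * (f \<mu> x)\<^sup>2"
      using log_convex_on_nonneg[OF lc] balanced(2) *
      by (intro antimono_imp_quarter_bound[of "\<lambda>\<mu>. f \<mu> x"]) auto
  qed (rule lc)
qed

end
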